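(* Let $m,n,d,n_2\ge 1$ and $n_1\ge 0$ be integers with $n_1+n_2=n$, $m>n$ and $m\ge n+d$. Let $A=[A_a,A_b]\in\mathbb{Q}_{\mathbb{R}}^{m\times n}$ with $A_a=A_{a0}+A_{a1}\mathbf{i}+A_{a2}\mathbf{j}+A_{a3}\mathbf{k}\in\mathbb{Q}_{\mathbb{R}}^{m\times n_1}$ of full column rank and $A_b=A_{b0}+A_{b1}\mathbf{i}+A_{b2}\mathbf{j}+A_{b3}\mathbf{k}\in\mathbb{Q}_{\mathbb{R}}^{m\times n_2}$, and let $B=B_0+B_1\mathbf{i}+B_2\mathbf{j}+B_3\mathbf{k}\in\mathbb{Q}_{\mathbb{R}}^{m\times d}$ (all components real matrices). Put $C_a=[A_{a0}^T,A_{a1}^T,A_{a2}^T,A_{a3}^T]^T\in\mathbb{R}^{4m\times n_1}$, $C_b=[A_{b0}^T,A_{b1}^T,A_{b2}^T,A_{b3}^T]^T\in\mathbb{R}^{4m\times n_2}$, $D=[B_0^T,B_1^T,B_2^T,B_3^T]^T\in\mathbb{R}^{4m\times d}$. Let $Q\in\mathbb{R}^{4m\times 4m}$ be an orthogonal matrix (a product of $n_1$ Householder transformations) such that $$Q^T[C_a,C_b,D]=\begin{bmatrix} R_{11} & R_{12} & R_{1d} \\ 0 & R_{22} & R_{2d} \end{bmatrix},$$ where $R_{11}\in\mathbb{R}^{n_1\times n_1}$ is upper triangular, $R_{12}\in\mathbb{R}^{n_1\times n_2}$, $R_{1d}\in\mathbb{R}^{n_1\times d}$, $R_{22}\in\mathbb{R}^{(4m-n_1)\times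 n_2}$, $R_{2d}\in\mathbb{R}^{(4m-n_1)\times d}$. Let $[R_{22},R_{2d}]=U\Sigma V^T$ be a singular value decomposition with $U\in\mathbb{R}^{(4m-n_1)\times(4m-n_1)}$ and $V\in\mathbb{R}^{(n_2+d)\times(n_2+d)}$ orthogonal and singular values $$\sigma_1\ge\sigma_2\ge\cdots\ge\sigma_{n_2}\ge\sigma_{n_2+1}\ge\cdots\ge\sigma_{n_2+d}>0,$$ and partition $V=\begin{bmatrix} V_{11} & V_{12} \\ V_{21} & V_{22} \end{bmatrix}$ with $V_{11}\in\mathbb{R}^{n_2\times n_2}$, $V_{12}\in\mathbb{R}^{n_2\times d}$, $V_{21}\in\mathbb{R}^{d\times n_2}$, $V_{22}\in\mathbb{R}^{d\times d}$. If $\sigma_{n_2}>\sigma_{n_2+1}$ and $V_{22}$ is nonsingular, then the real RBMTLS solution (for $A_a,A_b,B$) exists and is unique, and it is given by $$X=\begin{bmatrix} R_{11}^{-1}R_{1d} \\ 0 \end{bmatrix}+\begin{bmatrix} R_{11}^{-1}R_{12} \\ -I_{n_2} \end{bmatrix}V_{12}V_{22}^{-1}.$$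
   Context: Reduced biquaternions: $\mathbb{Q}_{\mathbb{R}}$ is the commutative real algebra of elements $a=a_0+a_1\mathbf{i}+a_2\mathbf{j}+a_3\mathbf{k}$ ($a_t\in\mathbb{R}$) with $\mathbf{i}^2=\mathbf{k}^2=-1$, $\mathbf{j}^2=1$, $\mathbf{i}\mathbf{j}=\mathbf{j}\mathbf{i}=\mathbf{k}$, $\mathbf{j}\mathbf{k}=\mathbf{k}\mathbf{j}=\mathbf{i}$, $\mathbf{k}\mathbf{i}=\mathbf{i}\mathbf{k}=-\mathbf{j}$. The norm is $\|a\|=\sqrt{a_0^2+a_1^2+a_2^2+a_3^2}$, and for $M=(m_{ij})$ over $\mathbb{Q}_{\mathbb{R}}$, $\|M\|_F=\big(\sum_{i,j}\|m_{ij}\|^2\big)^{1/2}$. Real matrices are viewed as matrices over $\mathbb{Q}_{\mathbb{R}}$. A matrix over $\mathbb{Q}_{\mathbb{R}}$ with columns $v_1,\dots,v_p$ has full column rank if the only real scalars with $x_1v_1+\cdots+x_pv_p=0$ are $x_1=\cdots=x_p=0$. RBMTLS problem (unknown $X$ real): minimize $\|[\widehat E_b,\widehat G]\|_F$ over $X_a\in\mathbb{R}^{n_1\times d}$, $X_b\in\mathbb{R}^{n_2\times d}$, $\widehat E_b\in\mathbb{Q}_{\mathbb{R}}^{m\times n_2}$, $\widehat G\in\mathbb{Q}_{\mathbb{R}}^{m\times d}$ subject to $A_aX_a+(A_b+\widehat E_b)X_b=B+\widehat G$. A real RBMTLS solution is a real $X=[X_a^T,X_b^T]^T\in\mathbb{R}^{n\times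 d}$ for which there are $\widehat E_b,\widehat G$ such that $(X_a,X_b,\widehat E_b,\widehat G)$ is feasible and attains the minimum. If $n_1=0$, the corresponding blocks are empty. *)

theory Defs
  imports Complex_Main "Jordan_Normal_Form.Gauss_Jordan_Elimination"
begin

section \<open>Reduced biquaternions\<close>

text \<open>\<open>RBQ a0 a1 a2 a3\<close> stands for \<open>a0 + a1 i + a2 j + a3 k\<close>; see \<open>rbq_decomp\<close> below.\<close>

datatype rbq = RBQ (rb0: real) (rb1: real) (rb2: real) (rb3: real)

lemma rbq_eq_iff: "a = b \<longleftrightarrow> rb0 a = rb0 b \<and> rb1 a = rb1 b \<and> rb2 a = rb2 b \<and> rb3 a = rb3 b"
  by (cases a; cases b) auto

instantiation rbq :: comm_ring_1
begin

definition zero_rbq_def: "0 = RBQ 0 0 0 0"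

definition one_rbq_def: "1 = RBQ 1 0 0 0"

definition plus_rbq_def:
  "a + b = RBQ (rb0 a + rb0 b) (rb1 a + rb1 b) (rb2 a + rb2 b) (rb3 a + rb3 b)"

definition minus_rbq_def:
  "a - b = RBQ (rb0 a - rb0 b) (rb1 a - rb1 b) (rb2 a - rb2 b) (rb3 a - rb3 b)"

definition uminus_rbq_def:
  "- a = RBQ (- rb0 a) (- rb1 a) (- rb2 a) (- rb3 a)"

text \<open>The bilinear extension of the multiplication table proved in \<open>rbq_mult_table\<close>.\<close>

definition times_rbq_def:
  "a * b = RBQ
     (rb0 a * rb0 b - rb1 a * rb1 b + rb2 a * rb2 b - rb3 a * rb3 b)
     (rb0 a * rb1 b + rb1 a * rb0 b + rb2 a * rb3 b + rb3 a * rb2 b)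
     (rb0 a * rb2 b + rb2 a * rb0 b - rb1 a * rb3 b - rb3 a * rb1 b)
     (rb0 a * rb3 b + rb3 a * rb0 b + rb1 a * rb2 b + rb2 a * rb1 b)"

instance
  by standard
    (simp_all add: rbq_eq_iff zero_rbq_def one_rbq_def plus_rbq_def minus_rbq_def
      uminus_rbq_def times_rbq_def algebra_simps)

end

instantiation rbq :: real_algebra_1
begin

definition scaleR_rbq_def:
  "scaleR r a = RBQ (r * rb0 a) (r * rb1 a) (r * rb2 a) (r * rb3 a)"

instance
  by standard
    (simp_all add: rbq_eq_iff plus_rbq_def times_rbq_def scaleR_rbq_def algebra_simps)

end

instantiation rbq :: real_normed_vector
begin

definition norm_rbq_def:
  "norm a = sqrt ((rb0 a)\<^sup>2 + (rb1 a)\<^sup>2 + (rb2 a)\<^sup>2 + (rb3 a)\<^sup>2)"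

definition sgn_rbq_def: "sgn (a :: rbq) = a /\<^sub>R norm a"

definition dist_rbq_def: "dist (a :: rbq) b = norm (a - b)"

definition uniformity_rbq_def [code del]:
  "(uniformity :: (rbq \<times> rbq) filter) = (INF e\<in>{0 <..}. principal {(x, y). dist x y < e})"

definition open_rbq_def [code del]:
  "open (U :: rbq set) \<longleftrightarrow> (\<forall>x\<in>U. eventually (\<lambda>(x', y). x' = x \<longrightarrow> y \<in> U) uniformity)"

instance
proof
  fix r :: real and a b :: rbq and S :: "rbq set"
  show "(norm a = 0) = (a = 0)"
    by (simp add: norm_rbq_def zero_rbq_def rbq_eq_iff add_nonneg_eq_0_iff)
  show "norm (r *\<^sub>R a) = \<bar>r\<bar> * norm a"
    by (simp add: norm_rbq_def scaleR_rbq_def power_mult_distrib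
        flip: distrib_left real_sqrt_abs real_sqrt_mult)
  define z :: "rbq \<Rightarrow> real" where "z c = cmod (Complex (rb0 c) (rb1 c))" for c
  define w :: "rbq \<Rightarrow> real" where "w c = cmod (Complex (rb2 c) (rb3 c))" for c
  have split: "norm c = sqrt ((z c)\<^sup>2 + (w c)\<^sup>2)" for c
    by (simp add: norm_rbq_def z_def w_def cmod_power2 add.assoc)
  have zle: "z (a + b) \<le> z a + z b"
    unfolding z_def by (rule order_trans[OF _ norm_triangle_ineq]) (simp add: plus_rbq_def complex_add)
  have wle: "w (a + b) \<le> w a + w b"
    unfolding w_def by (rule order_trans[OF _ norm_triangle_ineq]) (simp add: plus_rbq_def complex_add)
  have "0 \<le> z (a + b)" "0 \<le> w (a + b)"
    by (simp_all add: z_def w_def)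
  then have "norm (a + b) \<le> sqrt ((z a + z b)\<^sup>2 + (w a + w b)\<^sup>2)"
    unfolding split using zle wle by (intro real_sqrt_le_mono add_mono power_mono) auto
  also have "\<dots> \<le> norm a + norm b"
    unfolding split by (rule real_sqrt_sum_squares_triangle_ineq)
  finally show "norm (a + b) \<le> norm a + norm b" .
qed (simp_all add: sgn_rbq_def dist_rbq_def uniformity_rbq_def open_rbq_def)

end

definition rbq_i :: rbq where "rbq_i = RBQ 0 1 0 0"
definition rbq_j :: rbq where "rbq_j = RBQ 0 0 1 0"
definition rbq_k :: rbq where "rbq_k = RBQ 0 0 0 1"

lemmas rbq_unit_defs = rbq_i_def rbq_j_def rbq_k_def

lemma rbq_mult_table:
  "rbq_i * rbq_i = - 1" "rbq_k * rbq_k = - 1" "rbq_j * rbq_j = 1"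
  "rbq_i * rbq_j = rbq_k" "rbq_j * rbq_i = rbq_k"
  "rbq_j * rbq_k = rbq_i" "rbq_k * rbq_j = rbq_i"
  "rbq_k * rbq_i = - rbq_j" "rbq_i * rbq_k = - rbq_j"
  by (simp_all add: rbq_unit_defs times_rbq_def one_rbq_def uminus_rbq_def)

lemma of_real_rbq: "(of_real r :: rbq) = RBQ r 0 0 0"
  by (simp add: of_real_def scaleR_rbq_def one_rbq_def)

lemma rbq_decomp:
  "RBQ a0 a1 a2 a3 = of_real a0 + of_real a1 * rbq_i + of_real a2 * rbq_j + of_real a3 * rbq_k"
  by (simp add: of_real_rbq rbq_unit_defs times_rbq_def plus_rbq_def)


section \<open>Matrices\<close>

definition append_cols :: "'a::zero mat \<Rightarrow> 'a mat \<Rightarrow> 'a mat" (infixr \<open>@\<^sub>c\<close> 65) where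
  "A @\<^sub>c B = four_block_mat A B (0\<^sub>m 0 (dim_col A)) (0\<^sub>m 0 (dim_col B))"

abbreviation rbq_mat_of_real :: "real mat \<Rightarrow> rbq mat" where
  "rbq_mat_of_real \<equiv> map_mat of_real"

definition frobenius_norm :: "rbq mat \<Rightarrow> real" where
  "frobenius_norm M = sqrt (\<Sum>i<dim_row M. \<Sum>j<dim_col M. (norm (M $$ (i, j)))\<^sup>2)"

text \<open>Independence of the columns over the reals, not over the reduced biquaternions.\<close>

definition full_column_rank :: "rbq mat \<Rightarrow> bool" where
  "full_column_rank M \<longleftrightarrow>
     (\<forall>x :: real vec. x \<in> carrier_vec (dim_col M) \<longrightarrow>
        M *\<^sub>v map_vec of_real x = 0\<^sub>v (dim_row M) \<longrightarrow> x = 0\<^sub>v (dim_col M))"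

text \<open>The real matrix \<open>[M0; M1; M2; M3]\<close> of stacked components of \<open>M0 + M1 i + M2 j + M3 k\<close>.\<close>

definition stack_components :: "rbq mat \<Rightarrow> real mat" where
  "stack_components M = map_mat rb0 M @\<^sub>r map_mat rb1 M @\<^sub>r map_mat rb2 M @\<^sub>r map_mat rb3 M"

text \<open>The library predicate \<^const>\<open>orthogonal_mat\<close> only asks for pairwise orthogonal nonzero
  columns; here the columns are orthonormal.\<close>

definition real_orthogonal :: "nat \<Rightarrow> real mat \<Rightarrow> bool" where
  "real_orthogonal k Q \<longleftrightarrow>
     Q \<in> carrier_mat k k \<and> transpose_mat Q * Q = 1\<^sub>m k \<and> Q * transpose_mat Q = 1\<^sub>m k"

definition householder :: "nat \<Rightarrow> real mat \<Rightarrow> bool" where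
  "householder k H \<longleftrightarrow>
     (\<exists>v. v \<in> carrier_vec k \<and> v \<noteq> 0\<^sub>v k \<and>
        H = 1\<^sub>m k - (2 / (v \<bullet> v)) \<cdot>\<^sub>m mat k k (\<lambda>(i, j). v $ i * v $ j))"

text \<open>Rectangular diagonal matrix; the diagonal \<open>s 1, s 2, \<dots>\<close> is numbered from 1.\<close>

definition rect_diag :: "nat \<Rightarrow> nat \<Rightarrow> (nat \<Rightarrow> real) \<Rightarrow> real mat" where
  "rect_diag nr nc s = mat nr nc (\<lambda>(i, j). if i = j then s (Suc i) else 0)"

text \<open>Meaningful for invertible matrices only.\<close>

abbreviation mat_inv :: "real mat \<Rightarrow> real mat" where
  "mat_inv M \<equiv> the (mat_inverse M)"


section \<open>The mixed total least squares problem with real unknown\<close>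

definition RBMTLS_feasible ::
  "rbq mat \<Rightarrow> rbq mat \<Rightarrow> rbq mat \<Rightarrow> real mat \<Rightarrow> real mat \<Rightarrow> rbq mat \<Rightarrow> rbq mat \<Rightarrow> bool" where
  "RBMTLS_feasible Aa Ab B Xa Xb Eb G \<longleftrightarrow>
     Xa \<in> carrier_mat (dim_col Aa) (dim_col B) \<and>
     Xb \<in> carrier_mat (dim_col Ab) (dim_col B) \<and>
     Eb \<in> carrier_mat (dim_row B) (dim_col Ab) \<and>
     G \<in> carrier_mat (dim_row B) (dim_col B) \<and>
     Aa * rbq_mat_of_real Xa + (Ab + Eb) * rbq_mat_of_real Xb = B + G"

definition RBMTLS_minimizer ::
  "rbq mat \<Rightarrow> rbq mat \<Rightarrow> rbq mat \<Rightarrow> real mat \<Rightarrow> real mat \<Rightarrow> rbq mat \<Rightarrow> rbq mat \<Rightarrow> bool" where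
  "RBMTLS_minimizer Aa Ab B Xa Xb Eb G \<longleftrightarrow>
     RBMTLS_feasible Aa Ab B Xa Xb Eb G \<and>
     (\<forall>Xa' Xb' Eb' G'. RBMTLS_feasible Aa Ab B Xa' Xb' Eb' G' \<longrightarrow>
        frobenius_norm (Eb @\<^sub>c G) \<le> frobenius_norm (Eb' @\<^sub>c G'))"

definition real_RBMTLS_solution :: "rbq mat \<Rightarrow> rbq mat \<Rightarrow> rbq mat \<Rightarrow> real mat \<Rightarrow> bool" where
  "real_RBMTLS_solution Aa Ab B X \<longleftrightarrow>
     (\<exists>Xa Xb Eb G. X = Xa @\<^sub>r Xb \<and> RBMTLS_minimizer Aa Ab B Xa Xb Eb G)"

end

theory Submission
  imports Defs "Jordan_Normal_Form.Determinant"
begin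

text \<open>
  Stacking the four real components of every entry is an isometry that turns the problem into a real
  one, and \<open>Q\<^sup>T\<close> splits that into rows in which \<open>X\<^sub>a\<close> can be solved for exactly, at no cost, and the
  ordinary total least squares problem for \<open>[R\<^sub>2\<^sub>2, R\<^sub>2\<^sub>d]\<close>. In singular coordinates the latter reads
  \<open>(\<Sigma> + E) Y = 0\<close> with \<open>Y = V\<^sup>T [X\<^sub>b; -I]\<close>. If \<open>P\<close> is the orthogonal projection onto the range of \<open>Y\<close>, then
  \<open>E P = - \<Sigma> P\<close>, so the cost of \<open>E\<close> is at least \<open>\<Sum> \<sigma>\<^sub>i\<^sup>2 P\<^sub>i\<^sub>i\<close>, where \<open>0 \<le> P\<^sub>i\<^sub>i \<le> 1\<close> and \<open>tr P = d\<close>.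
  Hence it is at least the sum of the \<open>d\<close> smallest \<open>\<sigma>\<^sub>i\<^sup>2\<close>, and by the gap equality forces the
  first \<open>n\<^sub>2\<close> rows of \<open>Y\<close> to vanish, which determines \<open>X\<^sub>b\<close>.
\<close>

section \<open>Block matrices\<close>

lemma dim_append_rows [simp]:
  "dim_row (A @\<^sub>r B) = dim_row A + dim_row B" "dim_col (A @\<^sub>r B) = dim_col A"
  unfolding append_rows_def by simp_all

lemma dim_append_cols [simp]:
  "dim_row (A @\<^sub>c B) = dim_row A" "dim_col (A @\<^sub>c B) = dim_col A + dim_col B"
  unfolding append_cols_def by simp_all

lemma index_append_rows:
  assumes "i < dim_row A + dim_row B" "j < dim_col A"
  shows "(A @\<^sub>r B) $$ (i, j) = (if i < dim_row A then A $$ (i, j) else B $$ (i - dim_row A, j))"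
  using assms by (simp add: append_rows_def)

lemma index_append_cols:
  assumes "i < dim_row A" "j < dim_col A + dim_col B"
  shows "(A @\<^sub>c B) $$ (i, j) = (if j < dim_col A then A $$ (i, j) else B $$ (i, j - dim_col A))"
  using assms by (simp add: append_cols_def)

lemma append_cols_carrier [intro]:
  "A \<in> carrier_mat r a \<Longrightarrow> B \<in> carrier_mat r b \<Longrightarrow> A @\<^sub>c B \<in> carrier_mat r (a + b)"
  by (intro carrier_matI) auto

lemma append_rows_eq_iff:
  assumes "dim_row A = dim_row C" "dim_row B = dim_row D"
    and "dim_col A = dim_col B" "dim_col C = dim_col D"
  shows "A @\<^sub>r B = C @\<^sub>r D \<longleftrightarrow> A = C \<and> B = D"
proof
  assume eq: "A @\<^sub>r B = C @\<^sub>r D"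
  have col: "dim_col A = dim_col C"
    using arg_cong[OF eq, of dim_col] by simp
  have "A $$ (i, j) = C $$ (i, j)" if "i < dim_row C" "j < dim_col C" for i j
    using arg_cong[OF eq, of "\<lambda>M. M $$ (i, j)"] assms col that by (simp add: index_append_rows)
  moreover have "B $$ (i, j) = D $$ (i, j)" if "i < dim_row D" "j < dim_col D" for i j
    using arg_cong[OF eq, of "\<lambda>M. M $$ (dim_row A + i, j)"] assms col that
    by (simp add: index_append_rows)
  ultimately show "A = C \<and> B = D"
    using assms col by (auto intro!: eq_matI)
qed simp

lemma append_cols_eq_iff:
  assumes "A \<in> carrier_mat r a" "C \<in> carrier_mat r a" "B \<in> carrier_mat r b" "D \<in> carrier_mat r b"
  shows "A @\<^sub>c B = C @\<^sub>c D \<longleftrightarrow> A = C \<and> B = D"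
proof
  assume eq: "A @\<^sub>c B = C @\<^sub>c D"
  have "A $$ (i, j) = C $$ (i, j)" if "i < r" "j < a" for i j
    using arg_cong[OF eq, of "\<lambda>M. M $$ (i, j)"] assms that by (simp add: index_append_cols)
  moreover have "B $$ (i, j) = D $$ (i, j)" if "i < r" "j < b" for i j
    using arg_cong[OF eq, of "\<lambda>M. M $$ (i, a + j)"] assms that by (simp add: index_append_cols)
  ultimately show "A = C \<and> B = D"
    using assms by auto
qed simp

lemma append_rows_mult:
  fixes A B X :: "'a :: semiring_0 mat"
  assumes "dim_col A = dim_row X" "dim_col B = dim_row X"
  shows "(A @\<^sub>r B) * X = (A * X) @\<^sub>r (B * X)"
  using assms by (intro eq_matI) (auto simp: index_append_rows scalar_prod_def)

lemma mult_append_cols: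
  fixes A B X :: "'a :: semiring_0 mat"
  assumes "A \<in> carrier_mat k a" "B \<in> carrier_mat k b" "X \<in> carrier_mat r k"
  shows "X * (A @\<^sub>c B) = (X * A) @\<^sub>c (X * B)"
  using assms by (intro eq_matI) (auto simp: index_append_cols scalar_prod_def)

lemma append_cols_mult_append_rows:
  fixes A B C D :: "'a :: semiring_0 mat"
  assumes A: "A \<in> carrier_mat r a" and B: "B \<in> carrier_mat r b"
    and C: "C \<in> carrier_mat a c" and D: "D \<in> carrier_mat b c"
  shows "(A @\<^sub>c B) * (C @\<^sub>r D) = A * C + B * D"
proof -
  have "(\<Sum>k = 0..<a + b. f k) = (\<Sum>k = 0..<a. f k) + (\<Sum>k = 0..<b. f (a + k))" for f :: "nat \<Rightarrow> 'a"
    by (induction b) (simp_all add: add.assoc)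
  then show ?thesis
    using assms by (intro eq_matI) (auto simp: index_append_cols index_append_rows scalar_prod_def)
qed

lemma add_append_rows:
  assumes "dim_row A = dim_row C" "dim_row B = dim_row D"
    and "dim_col A = dim_col C" "dim_col B = dim_col D" "dim_col A = dim_col B"
  shows "(A @\<^sub>r B) + (C @\<^sub>r D) = (A + C) @\<^sub>r (B + D)"
  using assms by (intro eq_matI) (auto simp: index_append_rows)

lemma add_append_cols:
  assumes "A \<in> carrier_mat r a" "B \<in> carrier_mat r b" "C \<in> carrier_mat r a" "D \<in> carrier_mat r b"
  shows "(A @\<^sub>c B) + (C @\<^sub>c D) = (A + C) @\<^sub>c (B + D)"
  using assms by (intro eq_matI) (auto simp: index_append_cols)

text \<open>Regrouping block rows as block columns lets the triangularised block identity be read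
  one column block at a time.\<close>

lemma append_append_cols_append_rows:
  assumes "A \<in> carrier_mat r a" "B \<in> carrier_mat r b" "C \<in> carrier_mat s a" "D \<in> carrier_mat s b"
  shows "(A @\<^sub>c B) @\<^sub>r (C @\<^sub>c D) = (A @\<^sub>r C) @\<^sub>c (B @\<^sub>r D)"
  by (rule eq_matI)
    (use assms in \<open>auto simp: append_rows_def append_cols_def\<close>)

lemma obtain_append_rows:
  assumes M: "M \<in> carrier_mat (a + b) c"
  obtains A B where "A \<in> carrier_mat a c" "B \<in> carrier_mat b c" "M = A @\<^sub>r B"
proof
  show "mat a c (($$) M) \<in> carrier_mat a c" "mat b c (\<lambda>(i, j). M $$ (a + i, j)) \<in> carrier_mat b c"
    by simp_all
  then show "M = mat a c (($$) M) @\<^sub>r mat b c (\<lambda>(i, j). M $$ (a + i, j))"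
    using M by (intro eq_matI) (auto simp: index_append_rows)
qed

lemma obtain_append_cols:
  assumes M: "M \<in> carrier_mat r (a + b)"
  obtains A B where "A \<in> carrier_mat r a" "B \<in> carrier_mat r b" "M = A @\<^sub>c B"
proof
  show "mat r a (($$) M) \<in> carrier_mat r a" "mat r b (\<lambda>(i, j). M $$ (i, a + j)) \<in> carrier_mat r b"
    by simp_all
  then show "M = mat r a (($$) M) @\<^sub>c mat r b (\<lambda>(i, j). M $$ (i, a + j))"
    using M by (intro eq_matI) (auto simp: index_append_cols)
qed

section \<open>The squared Frobenius norm\<close>

definition frob2 :: "real mat \<Rightarrow> real" where
  "frob2 M = (\<Sum>i<dim_row M. \<Sum>j<dim_col M. (M $$ (i, j))\<^sup>2)"

lemma frob2_nonneg: "0 \<le> frob2 M"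
  by (simp add: frob2_def sum_nonneg)

lemma frob2_eq_0D:
  assumes "frob2 M = 0" "M \<in> carrier_mat r c"
  shows "M = 0\<^sub>m r c"
proof (rule eq_matI)
  fix i j assume ij: "i < dim_row (0\<^sub>m r c :: real mat)" "j < dim_col (0\<^sub>m r c :: real mat)"
  have "\<forall>i<r. (\<Sum>j<c. (M $$ (i, j))\<^sup>2) = 0"
    using assms unfolding frob2_def by (subst (asm) sum_nonneg_eq_0_iff) (auto intro: sum_nonneg)
  then have "(\<Sum>j<c. (M $$ (i, j))\<^sup>2) = 0"
    using ij by simp
  then have "(M $$ (i, j))\<^sup>2 = 0"
    using ij by (subst (asm) sum_nonneg_eq_0_iff) auto
  then show "M $$ (i, j) = 0\<^sub>m r c $$ (i, j)"
    using ij by simp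
qed (use assms in auto)

lemma frob2_uminus [simp]: "frob2 (- M) = frob2 M"
  by (simp add: frob2_def)

lemma frob2_transpose [simp]: "frob2 (transpose_mat M) = frob2 M"
  unfolding frob2_def by (simp add: sum.swap[of _ "{..<dim_row M}"])

lemma frob2_append_rows:
  assumes "dim_col A = dim_col B"
  shows "frob2 (A @\<^sub>r B) = frob2 A + frob2 B"
proof -
  have "(\<Sum>i<a + b. f i) = (\<Sum>i<a. f i) + (\<Sum>i<b. f (a + i))"
    for f :: "nat \<Rightarrow> real" and a b
    by (induction b) simp_all
  then show ?thesis
    using assms by (simp add: frob2_def index_append_rows)
qed

lemma frob2_append_cols:
  assumes "A \<in> carrier_mat r a" "B \<in> carrier_mat r b"
  shows "frob2 (A @\<^sub>c B) = frob2 A + frob2 B"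
proof -
  have "transpose_mat (A @\<^sub>c B) = transpose_mat A @\<^sub>r transpose_mat B"
    using assms by (intro eq_matI) (auto simp: index_append_rows index_append_cols)
  then have "frob2 (A @\<^sub>c B) = frob2 (transpose_mat A @\<^sub>r transpose_mat B)"
    by (metis frob2_transpose)
  then show ?thesis
    using assms by (simp add: frob2_append_rows)
qed

text \<open>The squared norm is the trace of the Gram matrix, so whatever leaves the Gram matrix
  fixed, such as an isometry on the left, preserves the norm.\<close>

lemma frob2_eq_trace:
  "frob2 M = (\<Sum>j<dim_col M. (transpose_mat M * M) $$ (j, j))"
  unfolding frob2_def by (subst sum.swap) (simp add: scalar_prod_def power2_eq_square lessThan_atLeast0)

lemma frob2_mult_isometry:
  assumes "Q \<in> carrier_mat k r" "transpose_mat Q * Q = 1\<^sub>m r" "M \<in> carrier_mat r c"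
  shows "frob2 (Q * M) = frob2 M"
proof -
  have "transpose_mat (Q * M) * (Q * M) = transpose_mat M * (transpose_mat Q * Q * M)"
    using assms(1,3) by (simp add: transpose_mult[of _ k r _ c] assoc_mult_mat[of _ c r _ k _ c]
        assoc_mult_mat[of _ r k _ r _ c])
  also have "\<dots> = transpose_mat M * M"
    using assms by simp
  finally show ?thesis
    using assms(1,3) by (simp add: frob2_eq_trace)
qed

lemma trace_mult_commute:
  fixes A B :: "'a :: comm_semiring_0 mat"
  assumes "A \<in> carrier_mat a b" "B \<in> carrier_mat b a"
  shows "(\<Sum>i<a. (A * B) $$ (i, i)) = (\<Sum>i<b. (B * A) $$ (i, i))"
  using assms by (simp add: scalar_prod_def lessThan_atLeast0 mult.commute)
    (rule sum.swap)

text \<open>Pythagoras: the diagonal of \<open>H * transpose_mat F\<close> collects, row by row, the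
  cross terms of the expanded square.\<close>

lemma frob2_add_orthogonal:
  assumes H: "H \<in> carrier_mat p q" and F: "F \<in> carrier_mat p q" and HF: "H * transpose_mat F = 0\<^sub>m p p"
  shows "frob2 (H + F) = frob2 H + frob2 F"
proof -
  have "(\<Sum>j<q. H $$ (i, j) * F $$ (i, j)) = 0" if "i < p" for i
    using arg_cong[OF HF, of "\<lambda>M. M $$ (i, i)"] that H F by (simp add: scalar_prod_def lessThan_atLeast0)
  then show ?thesis
    using H F by (simp add: frob2_def power2_sum sum.distrib mult.assoc flip: sum_distrib_left)
qed

text \<open>\<open>E\<close> splits into \<open>E * P\<close> and \<open>E - E * P\<close>. Symmetry
  and idempotence of \<open>P\<close> make the two parts orthogonal, and Pythagoras then drops the
  second one.\<close>

lemma frob2_projection_le: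
  assumes E: "E \<in> carrier_mat p q" and P: "P \<in> carrier_mat q q"
    "transpose_mat P = P" "P * P = P"
  shows "frob2 (E * P) \<le> frob2 E"
proof -
  define H where "H = E * P"
  have H: "H \<in> carrier_mat p q"
    using E P by (simp add: H_def)
  have tH: "transpose_mat H = P * transpose_mat E"
    using E P by (simp add: H_def transpose_mult[of _ p q _ q])
  have HP: "H * P = H"
    using E P by (simp add: H_def assoc_mult_mat[of _ p q _ q _ q])
  have tE: "transpose_mat E \<in> carrier_mat q p"
    using E by simp
  have "H * transpose_mat (E - H) = H * (transpose_mat E - P * transpose_mat E)"
    using E H by (simp add: transpose_minus[of _ p q] tH)
  also have "\<dots> = H * transpose_mat E - H * (P * transpose_mat E)"
    using P(1) tE H by (intro mult_minus_distrib_mat) auto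
  also have "H * (P * transpose_mat E) = H * transpose_mat E"
    using HP assoc_mult_mat[OF H P(1) tE] by simp
  also have "H * transpose_mat E - H * transpose_mat E = 0\<^sub>m p p"
    using H E by auto
  finally have "frob2 (H + (E - H)) = frob2 H + frob2 (E - H)"
    using E H by (intro frob2_add_orthogonal) auto
  moreover have "H + (E - H) = E"
    using E H by (intro eq_matI) auto
  ultimately show ?thesis
    using frob2_nonneg[of "E - H"] by (simp add: H_def)
qed

text \<open>For decreasing \<open>s\<close>, weights in [0, 1] of total \<open>d\<close> do best on
  the last \<open>d\<close> places. Every unit of weight among the first \<open>k\<close> places is
  missing from the tail, and this exchange costs at least \<open>s (k - 1) - s k\<close>. The gap
  term stays in the bound because uniqueness is read off from it.\<close>

lemma weighted_sum_ge_tail: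
  fixes s w :: "nat \<Rightarrow> real"
  assumes "0 < k"
    and mono: "\<And>i j. i \<le> j \<Longrightarrow> j < k + d \<Longrightarrow> s j \<le> s i"
    and w: "\<And>i. i < k + d \<Longrightarrow> 0 \<le> w i" "\<And>i. i < k + d \<Longrightarrow> w i \<le> 1"
    and sum_w: "(\<Sum>i<k + d. w i) = real d"
  shows "(\<Sum>i = k..<k + d. s i) + (s (k - 1) - s k) * (\<Sum>i<k. w i) \<le> (\<Sum>i<k + d. s i * w i)"
proof -
  have split: "(\<Sum>i<k + d. f i) = (\<Sum>i<k. f i) + (\<Sum>i = k..<k + d. f i)" for f :: "nat \<Rightarrow> real"
    using sum.atLeastLessThan_concat[of 0 k "k + d" f] by (simp add: lessThan_atLeast0)
  have "s (k - 1) * (\<Sum>i<k. w i) \<le> (\<Sum>i<k. s i * w i)"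
    unfolding sum_distrib_left using assms by (intro sum_mono mult_right_mono) auto
  moreover have "(\<Sum>i = k..<k + d. s i * (1 - w i)) \<le> (\<Sum>i = k..<k + d. s k * (1 - w i))"
    using w by (intro sum_mono mult_right_mono mono) auto
  \<comment> \<open>The total weight is \<open>d\<close>, the length of the tail, so the weight
    missing there is exactly the weight in the head.\<close>
  moreover have "(\<Sum>i = k..<k + d. s k * (1 - w i)) = s k * (\<Sum>i<k. w i)"
    using sum_w unfolding split by (simp add: sum_subtractf flip: sum_distrib_left)
  ultimately show ?thesis
    unfolding split by (simp add: algebra_simps sum_subtractf)
qed

section \<open>Orthogonal projections\<close>

text \<open>A trivial kernel forces a nonzero determinant, which makes the matrix a unit of the
  matrix ring. This serves both the Gram matrix of a projection and \<open>R11\<close>.\<close>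

lemma obtain_mat_inverse:
  fixes A :: "'a :: field mat"
  assumes A: "A \<in> carrier_mat n n"
    and inj: "\<And>v. v \<in> carrier_vec n \<Longrightarrow> A *\<^sub>v v = 0\<^sub>v n \<Longrightarrow> v = 0\<^sub>v n"
  obtains B where "B \<in> carrier_mat n n" "A * B = 1\<^sub>m n" "B * A = 1\<^sub>m n"
proof -
  have "det A \<noteq> 0"
    using det_0_iff_vec_prod_zero_field[OF A] inj by blast
  from det_non_zero_imp_unit[OF A this, of "()"] show thesis
    using that by (auto simp: Units_def ring_mat_def)
qed

text \<open>The inner product of \<open>Y v\<close> with itself equals that of
  \<open>Y^T Y v\<close> with \<open>v\<close>, which is zero.\<close>

lemma gram_kernel:
  fixes Y :: "real mat"
  assumes Y: "Y \<in> carrier_mat q d" and v: "v \<in> carrier_vec d"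
    and 0: "(transpose_mat Y * Y) *\<^sub>v v = 0\<^sub>v d"
  shows "Y *\<^sub>v v = 0\<^sub>v q"
proof -
  have Yv: "Y *\<^sub>v v \<in> carrier_vec q"
    using Y v by simp
  have "(Y *\<^sub>v v) \<bullet> (Y *\<^sub>v v) = (transpose_mat Y *\<^sub>v (Y *\<^sub>v v)) \<bullet> v"
    using transpose_vec_mult_scalar[OF Y v Yv] by simp
  also have "transpose_mat Y *\<^sub>v (Y *\<^sub>v v) = 0\<^sub>v d"
    using 0 Y v assoc_mult_mat_vec[of "transpose_mat Y" d q Y d v] by simp
  also have "0\<^sub>v d \<bullet> v = 0"
    using v by simp
  finally show ?thesis
    using conjugate_square_eq_0_vec[OF Yv] by simp
qed

text \<open>\<open>Z\<close> is the pseudoinverse \<open>(Y^T Y)^{-1} Y^T\<close>, and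
  \<open>Y * Z\<close> is the orthogonal projection onto the range of \<open>Y\<close>. The left
  inverse \<open>L\<close> makes \<open>Y\<close> injective and hence the Gram matrix invertible.
  The trace is \<open>d\<close> because \<open>Y * Z\<close> and \<open>Z * Y = 1\<close> have the
  same trace.\<close>

lemma obtain_projection:
  fixes Y L :: "real mat"
  assumes Y: "Y \<in> carrier_mat q d" and L: "L \<in> carrier_mat d q" and LY: "L * Y = 1\<^sub>m d"
  obtains Z where "Z \<in> carrier_mat d q" "transpose_mat (Y * Z) = Y * Z"
    "(Y * Z) * (Y * Z) = Y * Z" "Y * Z * Y = Y" "(\<Sum>i<q. (Y * Z) $$ (i, i)) = real d"
proof -
  define N where "N = transpose_mat Y * Y"
  have N: "N \<in> carrier_mat d d" and N_sym: "transpose_mat N = N"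
    using Y by (auto simp: N_def transpose_mult[of _ d q _ d])
  have inj: "v = 0\<^sub>v d" if v: "v \<in> carrier_vec d" and "N *\<^sub>v v = 0\<^sub>v d" for v
  proof -
    have "v = (L * Y) *\<^sub>v v"
      using LY v by simp
    also have "\<dots> = L *\<^sub>v (Y *\<^sub>v v)"
      using L Y v by simp
    also have "\<dots> = 0\<^sub>v d"
      using gram_kernel[OF Y] that L unfolding N_def by auto
    finally show ?thesis .
  qed
  obtain K where K: "K \<in> carrier_mat d d" and NK: "N * K = 1\<^sub>m d" and KN: "K * N = 1\<^sub>m d"
    using obtain_mat_inverse[OF N inj] by blast
  have K_sym: "transpose_mat K = K"
  proof -
    have "transpose_mat K = transpose_mat K * (N * K)"
      using K NK by simp
    also have "\<dots> = (transpose_mat K * transpose_mat N) * K"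
      using K N by (simp add: N_sym assoc_mult_mat[of _ d d _ d _ d])
    also have "\<dots> = transpose_mat (N * K) * K"
      using K N by (simp add: transpose_mult[of _ d d _ d])
    also have "\<dots> = K"
      using K by (simp add: NK)
    finally show ?thesis .
  qed
  define Z where "Z = K * transpose_mat Y"
  have tY: "transpose_mat Y \<in> carrier_mat d q"
    using Y by simp
  have Z: "Z \<in> carrier_mat d q"
    using K Y by (simp add: Z_def)
  have ZY: "Z * Y = 1\<^sub>m d"
    using assoc_mult_mat[OF K tY Y] KN by (simp add: Z_def N_def)
  have "transpose_mat Z = Y * K"
    using transpose_mult[OF K tY] by (simp add: Z_def K_sym)
  then have "transpose_mat (Y * Z) = Y * Z"
    using transpose_mult[OF Y Z] assoc_mult_mat[OF Y K tY] by (simp add: Z_def)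
  moreover have YZY: "Y * Z * Y = Y"
    using assoc_mult_mat[OF Y Z Y] ZY Y by simp
  moreover have "(Y * Z) * (Y * Z) = Y * Z"
    using assoc_mult_mat[OF mult_carrier_mat[OF Y Z] Y Z] YZY by simp
  moreover have "(\<Sum>i<q. (Y * Z) $$ (i, i)) = real d"
    using trace_mult_commute[OF Y Z] by (simp add: ZY)
  ultimately show thesis
    using that Z by blast
qed

section \<open>Total least squares\<close>

lemma rect_diag_carrier [simp]: "rect_diag p q s \<in> carrier_mat p q"
  by (simp add: rect_diag_def)

lemma dim_rect_diag [simp]: "dim_row (rect_diag p q s) = p" "dim_col (rect_diag p q s) = q"
  by (simp_all add: rect_diag_def)

lemma index_rect_diag_mult:
  assumes "P \<in> carrier_mat q c" "i < p" "j < c"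
  shows "(rect_diag p q s * P) $$ (i, j) = (if i < q then s (Suc i) * P $$ (i, j) else 0)"
proof -
  have "(rect_diag p q s * P) $$ (i, j) = (\<Sum>l = 0..<q. (if i = l then s (Suc i) else 0) * P $$ (l, j))"
    using assms by (simp add: rect_diag_def scalar_prod_def)
  also have "\<dots> = (\<Sum>l = 0..<q. if i = l then s (Suc i) * P $$ (i, j) else 0)"
    by (intro sum.cong) auto
  finally show ?thesis
    by simp
qed

lemma frob2_rect_diag_mult:
  assumes P: "P \<in> carrier_mat q c" and "q \<le> p"
  shows "frob2 (rect_diag p q s * P) = (\<Sum>i<q. (s (Suc i))\<^sup>2 * (\<Sum>j<c. (P $$ (i, j))\<^sup>2))"
proof -
  have "frob2 (rect_diag p q s * P)
      = (\<Sum>i<p. \<Sum>j<c. (if i < q then s (Suc i) * P $$ (i, j) else 0)\<^sup>2)"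
    using P by (simp add: frob2_def index_rect_diag_mult[OF P] del: index_mult_mat(1))
  also have "\<dots> = (\<Sum>i<p. if i < q then (s (Suc i))\<^sup>2 * (\<Sum>j<c. (P $$ (i, j))\<^sup>2) else 0)"
    by (intro sum.cong refl) (simp add: sum_distrib_left power_mult_distrib)
  also have "\<dots> = (\<Sum>i\<in>{..<p} \<inter> {i. i < q}. (s (Suc i))\<^sup>2 * (\<Sum>j<c. (P $$ (i, j))\<^sup>2))"
    by (simp add: sum.inter_restrict)
  also have "{..<p} \<inter> {i. i < q} = {..<q}"
    using assms by auto
  finally show ?thesis .
qed

lemma frob2_rect_diag:
  assumes "q \<le> p"
  shows "frob2 (rect_diag p q s) = (\<Sum>i<q. (s (Suc i))\<^sup>2)"
proof -
  have "(\<Sum>j<q. (1\<^sub>m q $$ (i, j))\<^sup>2) = (1 :: real)" if "i < q" for i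
  proof -
    have "(\<Sum>j<q. (1\<^sub>m q $$ (i, j))\<^sup>2) = (\<Sum>j<q. if i = j then 1 else (0 :: real))"
      using that by (intro sum.cong) auto
    then show ?thesis using that by simp
  qed
  then show ?thesis
    using frob2_rect_diag_mult[OF one_carrier_mat assms, of s]
    by (simp add: right_mult_one_mat[OF rect_diag_carrier])
qed

text \<open>An Eckart-Young type bound in singular coordinates. \<open>L\<close> certifies that the
  columns of \<open>Y\<close> are independent, so that the projection onto their span is available.
  Singular values are numbered from 1 but rows from 0, hence \<open>Suc i\<close>. The second claim
  is the rigidity that the gap provides.\<close>

lemma diagonal_tls:
  fixes E Y L :: "real mat"
  assumes k: "0 < k" "k + d \<le> p"
    and E: "E \<in> carrier_mat p (k + d)" and Y: "Y \<in> carrier_mat (k + d) d"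
    and L: "L \<in> carrier_mat d (k + d)" "L * Y = 1\<^sub>m d"
    and kernel: "(rect_diag p (k + d) \<sigma> + E) * Y = 0\<^sub>m p d"
    and mono: "\<And>i j. 1 \<le> i \<Longrightarrow> i \<le> j \<Longrightarrow> j \<le> k + d \<Longrightarrow> \<sigma> j \<le> \<sigma> i"
    and pos: "0 < \<sigma> (k + d)" and gap: "\<sigma> (k + 1) < \<sigma> k" and d: "0 < d"
  shows "(\<Sum>i = k..<k + d. (\<sigma> (Suc i))\<^sup>2) \<le> frob2 E"
    and "frob2 E \<le> (\<Sum>i = k..<k + d. (\<sigma> (Suc i))\<^sup>2) \<Longrightarrow> i < k \<Longrightarrow> j < d \<Longrightarrow> Y $$ (i, j) = 0"
proof -
  define q where "q = k + d"
  obtain Z where Z: "Z \<in> carrier_mat d q" and sym: "transpose_mat (Y * Z) = Y * Z"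
    and idem: "(Y * Z) * (Y * Z) = Y * Z" and PY: "Y * Z * Y = Y"
    and trace: "(\<Sum>i<q. (Y * Z) $$ (i, i)) = real d"
    using obtain_projection[OF Y L] unfolding q_def by blast
  define P where "P = Y * Z"
  define S where "S = rect_diag p q \<sigma>"
  have S: "S \<in> carrier_mat p q"
    by (simp add: S_def)
  have P: "P \<in> carrier_mat q q"
    using Y Z unfolding P_def q_def by simp
  have Eq: "E \<in> carrier_mat p q" and Yq: "Y \<in> carrier_mat q d"
    using E Y by (simp_all add: q_def)
  define w where "w i = P $$ (i, i)" for i
  \<comment> \<open>\<open>P\<close> is symmetric and idempotent, so
    \<open>P = P * transpose_mat P\<close> and its diagonal entries are the squared lengths of its
    rows.\<close>
  have w_eq: "w i = (\<Sum>j<q. (P $$ (i, j))\<^sup>2)" if "i < q" for i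
  proof -
    have "w i = (P * transpose_mat P) $$ (i, i)"
      using sym idem by (simp add: w_def P_def)
    then show ?thesis
      using P that by (simp add: scalar_prod_def power2_eq_square lessThan_atLeast0)
  qed
  have w_nonneg: "0 \<le> w i" if "i < q" for i
    using w_eq[OF that] by (simp add: sum_nonneg)
  have w_le: "w i \<le> 1" if "i < q" for i
  proof -
    \<comment> \<open>The square of the diagonal entry is one summand of the squared row length,
      which gives \<open>w i * w i \<le> w i\<close>.\<close>
    have "(P $$ (i, i))\<^sup>2 \<le> w i"
      unfolding w_eq[OF that] using that by (intro member_le_sum) auto
    then have "w i * w i \<le> w i * 1"
      by (simp add: w_def power2_eq_square)
    then show ?thesis
      using w_nonneg[OF that] by (cases "w i = 0") (auto simp: mult_le_cancel_left_pos)
  qed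
  have "(S + E) * P = 0\<^sub>m p q"
  proof -
    have "(S + E) * P = (S + E) * Y * Z"
      using assoc_mult_mat[OF _ Yq Z, of "S + E" p] Eq S by (simp add: P_def)
    also have "\<dots> = 0\<^sub>m p q"
      using kernel Z by (simp add: S_def q_def)
    finally show ?thesis .
  qed
  then have sum0: "S * P + E * P = 0\<^sub>m p q"
    using add_mult_distrib_mat[OF S Eq P] by simp
  have "E * P = - (S * P)"
  proof (rule eq_matI)
    fix i j assume "i < dim_row (- (S * P))" "j < dim_col (- (S * P))"
    then show "(E * P) $$ (i, j) = (- (S * P)) $$ (i, j)"
      using arg_cong[OF sum0, of "\<lambda>M. M $$ (i, j)"] S P Eq by (simp del: index_mult_mat(1))
  qed (use S P Eq in auto)
  then have "frob2 (E * P) = (\<Sum>i<q. (\<sigma> (Suc i))\<^sup>2 * w i)"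
    using frob2_rect_diag_mult[OF P, of p \<sigma>] k by (simp add: S_def w_eq q_def)
  moreover have "frob2 (E * P) \<le> frob2 E"
    using frob2_projection_le[OF Eq P] sym idem by (simp add: P_def)
  \<comment> \<open>The weights are the diagonal entries of \<open>P\<close>, whose sum is the trace
    \<open>d\<close>. Positivity of the singular values lets their order pass to the squares. Since
    \<open>k\<close> is positive, \<open>Suc (k - 1)\<close> is \<open>k\<close>.\<close>
  moreover have "(\<Sum>i = k..<k + d. (\<sigma> (Suc i))\<^sup>2)
      + ((\<sigma> (Suc (k - 1)))\<^sup>2 - (\<sigma> (Suc k))\<^sup>2) * (\<Sum>i<k. w i) \<le> (\<Sum>i<k + d. (\<sigma> (Suc i))\<^sup>2 * w i)"
  proof (rule weighted_sum_ge_tail[OF k(1)])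
    fix i j assume "i \<le> j" "j < k + d"
    moreover have "0 < \<sigma> (Suc j)"
      using mono[of "Suc j" "k + d"] pos \<open>j < k + d\<close> by simp
    ultimately show "(\<sigma> (Suc j))\<^sup>2 \<le> (\<sigma> (Suc i))\<^sup>2"
      using mono[of "Suc i" "Suc j"] by (intro power_mono) auto
  qed (use w_nonneg w_le trace in \<open>auto simp: q_def w_def P_def\<close>)
  ultimately have bound: "(\<Sum>i = k..<k + d. (\<sigma> (Suc i))\<^sup>2)
      + ((\<sigma> k)\<^sup>2 - (\<sigma> (k + 1))\<^sup>2) * (\<Sum>i<k. w i) \<le> frob2 E"
    using k by (simp add: q_def)
  have "0 < \<sigma> (k + 1)"
    using mono[of "k + 1" "k + d"] pos d by simp
  then have gap2: "0 < (\<sigma> k)\<^sup>2 - (\<sigma> (k + 1))\<^sup>2"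
    using gap by (simp add: power_strict_mono)
  have sum_nn: "0 \<le> (\<Sum>i<k. w i)"
    using w_nonneg by (intro sum_nonneg) (auto simp: q_def)
  show "(\<Sum>i = k..<k + d. (\<sigma> (Suc i))\<^sup>2) \<le> frob2 E"
    using bound mult_nonneg_nonneg[OF less_imp_le[OF gap2] sum_nn] by linarith
  assume le: "frob2 E \<le> (\<Sum>i = k..<k + d. (\<sigma> (Suc i))\<^sup>2)" and i: "i < k" and j: "j < d"
  have "((\<sigma> k)\<^sup>2 - (\<sigma> (k + 1))\<^sup>2) * (\<Sum>i<k. w i) \<le> 0"
    using bound le by linarith
  then have "(\<Sum>i<k. w i) = 0"
    using gap2 sum_nn by (simp add: mult_le_0_iff)
  then have "w i = 0"
    using i w_nonneg by (subst (asm) sum_nonneg_eq_0_iff) (auto simp: q_def)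
  then have "(\<Sum>l<q. (P $$ (i, l))\<^sup>2) = 0"
    using w_eq[of i] i by (simp add: q_def)
  then have row0: "P $$ (i, l) = 0" if "l < q" for l
    using that by (subst (asm) sum_nonneg_eq_0_iff) auto
  \<comment> \<open>\<open>P\<close> fixes \<open>Y\<close>, so a vanishing row of \<open>P\<close>
    makes the same row of \<open>Y\<close> vanish.\<close>
  have "Y $$ (i, j) = (P * Y) $$ (i, j)"
    using PY by (simp add: P_def)
  also have "\<dots> = 0"
    using P Yq i j row0 by (simp add: scalar_prod_def q_def)
  finally show "Y $$ (i, j) = 0" .
qed

lemma mult_minus_one_mat:
  fixes A :: "'a :: ring_1 mat"
  assumes A: "A \<in> carrier_mat r c"
  shows "A * (- 1\<^sub>m c) = - A"
  using uminus_mult_right_mat[of A "1\<^sub>m c"] A by simp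

lemma add_uminus_eq_mat_iff:
  fixes A B C :: "'a :: ring mat"
  assumes A: "A \<in> carrier_mat r c" and B: "B \<in> carrier_mat r c" and C: "C \<in> carrier_mat r c"
  shows "A + - B = C \<longleftrightarrow> A = C + B"
proof
  assume "A + - B = C"
  then have "C + B = (A + - B) + B" by simp
  also have "\<dots> = A" using A B by (intro eq_matI) auto
  finally show "A = C + B" ..
next
  assume "A = C + B"
  then show "A + - B = C" using A B C by (auto intro!: eq_matI)
qed

section \<open>Orthogonal invariance and the general total least squares problem\<close>

lemma real_orthogonalD:
  assumes "real_orthogonal k Q"
  shows "Q \<in> carrier_mat k k" "transpose_mat Q \<in> carrier_mat k k"
    "transpose_mat Q * Q = 1\<^sub>m k" "Q * transpose_mat Q = 1\<^sub>m k"
  using assms by (auto simp: real_orthogonal_def)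

lemma real_orthogonal_transpose: "real_orthogonal k Q \<Longrightarrow> real_orthogonal k (transpose_mat Q)"
  by (simp add: real_orthogonal_def)

lemma real_orthogonal_cancel:
  assumes Q: "real_orthogonal k Q" and M: "M \<in> carrier_mat k c"
  shows "transpose_mat Q * (Q * M) = M" "Q * (transpose_mat Q * M) = M"
  using assoc_mult_mat[of "transpose_mat Q" k k Q k M c] assoc_mult_mat[of Q k k "transpose_mat Q" k M c]
    real_orthogonalD[OF Q] M by simp_all

lemma frob2_orthogonal_left:
  "real_orthogonal k Q \<Longrightarrow> M \<in> carrier_mat k c \<Longrightarrow> frob2 (Q * M) = frob2 M"
  by (rule frob2_mult_isometry[OF real_orthogonalD(1,3)])

lemma frob2_orthogonal_right:
  assumes Q: "real_orthogonal k Q" and M: "M \<in> carrier_mat r k"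
  shows "frob2 (M * Q) = frob2 M"
proof -
  have "frob2 (M * Q) = frob2 (transpose_mat Q * transpose_mat M)"
    using M real_orthogonalD(1)[OF Q] by (metis frob2_transpose transpose_mult)
  also have "\<dots> = frob2 M"
    using frob2_orthogonal_left[OF real_orthogonal_transpose[OF Q], of "transpose_mat M" r] M by simp
  finally show ?thesis .
qed

text \<open>The homogeneous form of the constraint: it becomes a kernel condition on the augmented
  matrix, to which the SVD applies.\<close>

lemma tls_constraint_iff:
  fixes C D X :: "real mat"
  assumes "C \<in> carrier_mat p k" "D \<in> carrier_mat p d" "X \<in> carrier_mat k d"
  shows "(C @\<^sub>c D) * (X @\<^sub>r (- 1\<^sub>m d)) = 0\<^sub>m p d \<longleftrightarrow> C * X = D"
  using assms by (simp add: append_cols_mult_append_rows[of _ p k _ d] mult_minus_one_mat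
      add_uminus_eq_mat_iff[of _ p d])

text \<open>The ordinary total least squares problem for \<open>C\<close> and \<open>D\<close>, with
  an SVD of the augmented matrix; \<open>K\<close> is the inverse of \<open>V22\<close>. It is later
  instantiated with \<open>R22\<close> and \<open>R2d\<close>.\<close>

locale tls_svd =
  fixes p k d :: nat and C D U V V11 V12 V21 V22 K :: "real mat" and \<sigma> :: "nat \<Rightarrow> real"
  assumes dims: "0 < k" "0 < d" "k + d \<le> p"
    and C: "C \<in> carrier_mat p k" and D: "D \<in> carrier_mat p d"
    and U: "real_orthogonal p U" and V: "real_orthogonal (k + d) V"
    and SVD: "C @\<^sub>c D = U * rect_diag p (k + d) \<sigma> * transpose_mat V"
    and V_blocks: "V11 \<in> carrier_mat k k" "V12 \<in> carrier_mat k d"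
      "V21 \<in> carrier_mat d k" "V22 \<in> carrier_mat d d" "V = four_block_mat V11 V12 V21 V22"
    and K: "K \<in> carrier_mat d d" "K * V22 = 1\<^sub>m d" "V22 * K = 1\<^sub>m d"
    and sorted: "\<And>i. 1 \<le> i \<Longrightarrow> i < k + d \<Longrightarrow> \<sigma> (i + 1) \<le> \<sigma> i"
    and pos: "0 < \<sigma> (k + d)" and gap: "\<sigma> (k + 1) < \<sigma> k"
begin

text \<open>The optimal value of the problem: the squares of the \<open>d\<close> smallest singular
  values, with the index shifted by one.\<close>

definition tail :: real where "tail = (\<Sum>i = k..<k + d. (\<sigma> (Suc i))\<^sup>2)"

text \<open>Coordinates that vanish in the first \<open>k\<close> places only see the last
  \<open>d\<close> columns of \<open>V\<close>, the right singular vectors of the smallest singular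
  values.\<close>

lemma V_mult_tail:
  assumes T: "T \<in> carrier_mat d d"
  shows "V * (0\<^sub>m k d @\<^sub>r T) = V12 * T @\<^sub>r V22 * T"
proof -
  have left: "V11 @\<^sub>r V21 \<in> carrier_mat (k + d) k" and right: "V12 @\<^sub>r V22 \<in> carrier_mat (k + d) d"
    using V_blocks by auto
  have "V = (V11 @\<^sub>r V21) @\<^sub>c (V12 @\<^sub>r V22)"
    using V_blocks by (intro eq_matI) (auto simp: append_rows_def append_cols_def)
  then have "V * (0\<^sub>m k d @\<^sub>r T) = (V11 @\<^sub>r V21) * 0\<^sub>m k d + (V12 @\<^sub>r V22) * T"
    using append_cols_mult_append_rows[OF left right zero_carrier_mat T] by simp
  also have "\<dots> = (V12 @\<^sub>r V22) * T"
    using right_mult_zero_mat[OF left] mult_carrier_mat[OF right T] by simp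
  also have "\<dots> = V12 * T @\<^sub>r V22 * T"
    using V_blocks T by (intro append_rows_mult) auto
  finally show ?thesis .
qed

lemma \<sigma>_antimono:
  assumes "1 \<le> i" "i \<le> j" "j \<le> k + d"
  shows "\<sigma> j \<le> \<sigma> i"
  using assms(2,3)
proof (induction j rule: dec_induct)
  case (step j)
  then show ?case using sorted[of j] assms(1) by simp
qed simp

text \<open>Rotating by \<open>U\<close> and \<open>V\<close> preserves the cost and leads to the
  diagonal problem. At optimal cost the rotated \<open>[X; -1]\<close> has the form
  \<open>[0; T]\<close>, so \<open>[X; -1] = [V12 T; V22 T]\<close>. The lower block forces
  \<open>T = - K\<close>, and the upper block then gives \<open>X\<close>.\<close>

lemma bound:
  assumes E: "E \<in> carrier_mat p k" and G: "G \<in> carrier_mat p d" and X: "X \<in> carrier_mat k d"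
    and constr: "(C + E) * X = D + G"
  shows "tail \<le> frob2 E + frob2 G"
    and "frob2 E + frob2 G \<le> tail \<Longrightarrow> X = - (V12 * K)"
proof -
  note U' = real_orthogonalD[OF U] and V' = real_orthogonalD[OF V]
  define S where "S = rect_diag p (k + d) \<sigma>"
  define F where "F = E @\<^sub>c G"
  define W where "W = X @\<^sub>r (- 1\<^sub>m d)"
  define Y where "Y = transpose_mat V * W"
  define F' where "F' = transpose_mat U * F * V"
  \<comment> \<open>A left inverse of \<open>Y\<close>: \<open>V\<close> turns \<open>Y\<close> back
    into \<open>[X; -1]\<close>, and selecting the negated lower block of that leaves the
    identity.\<close>
  define L where "L = (0\<^sub>m d k @\<^sub>c (- 1\<^sub>m d)) * V"
  have S: "S \<in> carrier_mat p (k + d)" by (simp add: S_def)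
  have F: "F \<in> carrier_mat p (k + d)" using E G by (auto simp: F_def)
  have W: "W \<in> carrier_mat (k + d) d" using X by (auto simp: W_def)
  have Y: "Y \<in> carrier_mat (k + d) d" using V' W by (simp add: Y_def)
  have F': "F' \<in> carrier_mat p (k + d)" using U' V' F by (simp add: F'_def)
  have sel: "0\<^sub>m d k @\<^sub>c (- 1\<^sub>m d) \<in> carrier_mat d (k + d)" by (intro append_cols_carrier) simp_all
  then have L: "L \<in> carrier_mat d (k + d)" unfolding L_def using V'(1) by (rule mult_carrier_mat)
  have VY: "V * Y = W" by (simp add: Y_def real_orthogonal_cancel[OF V W])
  have "L * Y = (0\<^sub>m d k @\<^sub>c (- 1\<^sub>m d)) * W"
    using assoc_mult_mat[OF sel V'(1) Y] VY by (simp add: L_def)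
  also have "\<dots> = 0\<^sub>m d k * X + - 1\<^sub>m d * - 1\<^sub>m d"
    unfolding W_def using X by (intro append_cols_mult_append_rows) auto
  also have "\<dots> = 1\<^sub>m d"
    using X mult_minus_one_mat[of "- 1\<^sub>m d :: real mat" d d] by simp
  finally have LY: "L * Y = 1\<^sub>m d" .
  have "U * S * transpose_mat V + F = (C + E) @\<^sub>c (D + G)"
    using add_append_cols[OF C D E G] SVD by (simp add: S_def F_def)
  then have MW: "(U * S * transpose_mat V + F) * W = 0\<^sub>m p d"
    using tls_constraint_iff[of "C + E" p k "D + G" d X] C D E G X constr by (simp add: W_def)
  have USV: "U * S * transpose_mat V \<in> carrier_mat p (k + d)"
    using U' S V' by simp
  \<comment> \<open>Both summands are rewritten as \<open>transpose_mat U\<close> times a term in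
    \<open>W\<close>; together they are the rotated constraint \<open>MW\<close>.\<close>
  have "(S + F') * Y = S * Y + F' * Y"
    by (rule add_mult_distrib_mat[OF S F' Y])
  also have "S * Y = transpose_mat U * (U * (S * Y))"
    by (rule real_orthogonal_cancel(1)[OF U, symmetric]) (use S Y in auto)
  also have "U * (S * Y) = U * S * transpose_mat V * W"
    using assoc_mult_mat[OF U'(1) S Y] assoc_mult_mat[OF mult_carrier_mat[OF U'(1) S] V'(2) W]
    by (simp only: Y_def)
  also have "F' * Y = transpose_mat U * (F * W)"
    using assoc_mult_mat[OF mult_carrier_mat[OF U'(2) F] V'(1) Y] assoc_mult_mat[OF U'(2) F W]
    by (simp only: F'_def VY)
  also have "transpose_mat U * (U * S * transpose_mat V * W) + transpose_mat U * (F * W)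
      = transpose_mat U * (U * S * transpose_mat V * W + F * W)"
    by (rule mult_add_distrib_mat[symmetric, OF U'(2) mult_carrier_mat[OF USV W] mult_carrier_mat[OF F W]])
  also have "U * S * transpose_mat V * W + F * W = 0\<^sub>m p d"
    using add_mult_distrib_mat[OF USV F W] MW by simp
  finally have kernel: "(rect_diag p (k + d) \<sigma> + F') * Y = 0\<^sub>m p d"
    using U' by (simp add: S_def)
  have frob: "frob2 F' = frob2 E + frob2 G"
    using frob2_orthogonal_right[OF V, of "transpose_mat U * F" p] U' F
      frob2_orthogonal_left[OF real_orthogonal_transpose[OF U] F] frob2_append_cols[OF E G]
    by (simp add: F'_def F_def)
  note diag = diagonal_tls[OF dims(1,3) F' Y L LY kernel \<sigma>_antimono pos gap dims(2)]
  show "tail \<le> frob2 E + frob2 G"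
    using diag(1) frob by (simp add: tail_def)
  assume le: "frob2 E + frob2 G \<le> tail"
  obtain Y1 T where Y1: "Y1 \<in> carrier_mat k d" and T: "T \<in> carrier_mat d d" and Y_eq: "Y = Y1 @\<^sub>r T"
    using obtain_append_rows[OF Y] .
  have "Y1 $$ (i, j) = 0" if "i < k" "j < d" for i j
    using diag(2)[of i j] le frob that Y1 T by (simp add: tail_def Y_eq index_append_rows)
  then have "Y1 = 0\<^sub>m k d"
    using Y1 by auto
  then have "X @\<^sub>r (- 1\<^sub>m d) = V12 * T @\<^sub>r V22 * T"
    using VY V_mult_tail[OF T] by (simp add: W_def Y_eq)
  then have XT: "X = V12 * T" and "- 1\<^sub>m d = V22 * T"
    using append_rows_eq_iff[of X "V12 * T" "- 1\<^sub>m d" "V22 * T"] X V_blocks T by auto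
  then have "K * (- 1\<^sub>m d) = T"
    using assoc_mult_mat[OF K(1) V_blocks(4) T] K T by simp
  then have "T = - K"
    using mult_minus_one_mat[OF K(1)] by simp
  then show "X = - (V12 * K)"
    using XT K(1) V_blocks(2) by simp
qed

text \<open>Truncating the SVD after \<open>k\<close> singular values attains the bound: the
  truncated augmented matrix kills the last \<open>d\<close> columns of \<open>V\<close>, hence also
  their combination with lower block -1.\<close>

lemma attained:
  obtains E G where "E \<in> carrier_mat p k" "G \<in> carrier_mat p d"
    "(C + E) * (- (V12 * K)) = D + G" "frob2 E + frob2 G = tail"
proof -
  note U' = real_orthogonalD[OF U] and V' = real_orthogonalD[OF V]
  define S where "S = rect_diag p (k + d) \<sigma>"
  define S1 where "S1 = rect_diag p (k + d) (\<lambda>i. if i \<le> k then \<sigma> i else 0)"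
  \<comment> \<open>The correction that cancels the trailing singular values. The test
    \<open>i \<le> k\<close> uses the numbering from 1, so exactly the first \<open>k\<close>
    diagonal entries are left alone.\<close>
  define S2 where "S2 = rect_diag p (k + d) (\<lambda>i. if i \<le> k then 0 else - \<sigma> i)"
  define F where "F = U * S2 * transpose_mat V"
  have S: "S \<in> carrier_mat p (k + d)" "S1 \<in> carrier_mat p (k + d)" "S2 \<in> carrier_mat p (k + d)"
    by (simp_all add: S_def S1_def S2_def)
  have F: "F \<in> carrier_mat p (k + d)" using U' V' S by (simp add: F_def)
  obtain E G where E: "E \<in> carrier_mat p k" and G: "G \<in> carrier_mat p d" and F_eq: "F = E @\<^sub>c G"
    using obtain_append_cols[OF F] .
  have "S + S2 = S1"
    by (intro eq_matI) (auto simp: S_def S1_def S2_def rect_diag_def)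
  then have "U * S * transpose_mat V + F = U * S1 * transpose_mat V"
    using U' V' S by (simp add: F_def flip: add_mult_distrib_mat[of _ p "k + d" _ _ "k + d"] mult_add_distrib_mat[of _ p p _ "k + d"])
  moreover have "U * S * transpose_mat V + F = (C + E) @\<^sub>c (D + G)"
    using add_append_cols[OF C D E G] SVD by (simp add: S_def F_eq)
  ultimately have sum_eq: "(C + E) @\<^sub>c (D + G) = U * S1 * transpose_mat V"
    by simp
  have T: "- K \<in> carrier_mat d d" using K by simp
  \<comment> \<open>The factor \<open>- K\<close> normalises the lower block
    \<open>V22 * (- K)\<close> to -1.\<close>
  define Y where "Y = 0\<^sub>m k d @\<^sub>r (- K)"
  have Y: "Y \<in> carrier_mat (k + d) d"
    using T by (auto simp: Y_def)
  have W_eq: "- (V12 * K) @\<^sub>r (- 1\<^sub>m d) = V * Y"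
    using V_mult_tail[OF T] K V_blocks by (simp add: Y_def)
  have VY: "V * Y \<in> carrier_mat (k + d) d"
    using V' Y by simp
  have "((C + E) @\<^sub>c (D + G)) * (- (V12 * K) @\<^sub>r (- 1\<^sub>m d)) = U * S1 * Y"
    unfolding sum_eq W_eq using U' V' S Y assoc_mult_mat[OF _ V'(2) VY, of "U * S1" p]
    by (simp add: real_orthogonal_cancel[OF V Y])
  also have "\<dots> = U * (S1 * Y)"
    by (rule assoc_mult_mat[OF U'(1) S(2) Y])
  \<comment> \<open>The diagonal of \<open>S1\<close> lives on the first \<open>k\<close> places and
    \<open>Y\<close> on the last \<open>d\<close> rows.\<close>
  also have "S1 * Y = 0\<^sub>m p d"
  proof (rule eq_matI)
    fix i j assume "i < dim_row (0\<^sub>m p d :: real mat)" "j < dim_col (0\<^sub>m p d :: real mat)"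
    then show "(S1 * Y) $$ (i, j) = 0\<^sub>m p d $$ (i, j)"
      unfolding S1_def using index_rect_diag_mult[OF Y, of i p j] K
      by (auto simp: Y_def index_append_rows simp del: index_mult_mat(1))
  qed (use S Y in auto)
  finally have "((C + E) @\<^sub>c (D + G)) * (- (V12 * K) @\<^sub>r (- 1\<^sub>m d)) = 0\<^sub>m p d"
    using U' by simp
  then have "(C + E) * (- (V12 * K)) = D + G"
    using tls_constraint_iff[of "C + E" p k "D + G" d "- (V12 * K)"] C D E G V_blocks K by simp
  moreover have "frob2 E + frob2 G = tail"
  proof -
    have "frob2 E + frob2 G = frob2 F"
      using frob2_append_cols[OF E G] by (simp add: F_eq)
    also have "\<dots> = frob2 S2"
      using frob2_orthogonal_right[OF real_orthogonal_transpose[OF V], of "U * S2" p]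
        frob2_orthogonal_left[OF U S(3)] U' S by (simp add: F_def)
    also have "\<dots> = (\<Sum>i<k + d. if i < k then 0 else (\<sigma> (Suc i))\<^sup>2)"
      unfolding S2_def frob2_rect_diag[OF dims(3)] by (intro sum.cong) auto
    also have "\<dots> = (\<Sum>i = k..<k + d. if i < k then 0 else (\<sigma> (Suc i))\<^sup>2)"
      by (rule sum.mono_neutral_right) auto
    also have "\<dots> = tail"
      unfolding tail_def by (intro sum.cong) auto
    finally show ?thesis .
  qed
  ultimately show thesis
    using that E G by blast
qed

end

section \<open>Reduction to the real problem\<close>

lemma stack_components_carrier [intro]:
  assumes "M \<in> carrier_mat m c"
  shows "stack_components M \<in> carrier_mat (4 * m) c"
  using assms by (intro carrier_matI) (auto simp: stack_components_def)

lemma rb_add: "rb0 (a + b) = rb0 a + rb0 b" "rb1 (a + b) = rb1 a + rb1 b"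
  "rb2 (a + b) = rb2 a + rb2 b" "rb3 (a + b) = rb3 a + rb3 b"
  by (simp_all add: plus_rbq_def)

lemma rb_zero: "rb0 0 = 0" "rb1 0 = 0" "rb2 0 = 0" "rb3 0 = 0"
  by (simp_all add: zero_rbq_def)

lemma rb_sum: "rb0 (sum f S) = (\<Sum>x\<in>S. rb0 (f x))" "rb1 (sum f S) = (\<Sum>x\<in>S. rb1 (f x))"
  "rb2 (sum f S) = (\<Sum>x\<in>S. rb2 (f x))" "rb3 (sum f S) = (\<Sum>x\<in>S. rb3 (f x))"
  by (induction S rule: infinite_finite_induct; simp add: rb_add rb_zero)+

lemma rb_mult_of_real: "rb0 (a * of_real r) = rb0 a * r" "rb1 (a * of_real r) = rb1 a * r"
  "rb2 (a * of_real r) = rb2 a * r" "rb3 (a * of_real r) = rb3 a * r"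
  by (simp_all add: of_real_rbq times_rbq_def)

text \<open>A real factor acts on each of the four components separately. This is where it matters
  that the unknown is real.\<close>

lemma stack_components_mult_real:
  assumes M: "M \<in> carrier_mat m k" and X: "X \<in> carrier_mat k c"
  shows "stack_components (M * rbq_mat_of_real X) = stack_components M * X"
proof -
  have "map_mat f (M * rbq_mat_of_real X) = map_mat f M * X" if "f \<in> {rb0, rb1, rb2, rb3}" for f
    using that M X by (intro eq_matI) (auto simp: scalar_prod_def rb_sum rb_mult_of_real)
  then show ?thesis
    unfolding stack_components_def using M X by (simp add: append_rows_mult)
qed

lemma stack_components_add:
  assumes "M \<in> carrier_mat m c" "N \<in> carrier_mat m c"
  shows "stack_components (M + N) = stack_components M + stack_components N"
proof -
  have "map_mat f (M + N) = map_mat f M + map_mat f N" if "f \<in> {rb0, rb1, rb2, rb3}" for f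
    using that assms by (intro eq_matI) (auto simp: rb_add)
  then show ?thesis
    unfolding stack_components_def using assms by (simp add: add_append_rows)
qed

lemma stack_components_eq_iff:
  assumes "M \<in> carrier_mat m c" "N \<in> carrier_mat m c"
  shows "stack_components M = stack_components N \<longleftrightarrow> M = N"
proof
  assume eq: "stack_components M = stack_components N"
  have "map_mat f M = map_mat f N" if "f \<in> {rb0, rb1, rb2, rb3}" for f
    using eq that assms unfolding stack_components_def by (auto simp: append_rows_eq_iff)
  then have "f (M $$ (i, j)) = f (N $$ (i, j))" if "i < m" "j < c" "f \<in> {rb0, rb1, rb2, rb3}" for f i j
    using that assms by (metis carrier_matD(1) carrier_matD(2) index_map_mat(1))
  then show "M = N"
    using assms by (intro eq_matI) (auto simp: rbq_eq_iff)
qed simp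

text \<open>Surjectivity of stacking, by which an optimal real perturbation is lifted back to
  reduced biquaternions.\<close>

lemma obtain_stack_components:
  assumes E: "E \<in> carrier_mat (4 * m) c"
  obtains M where "M \<in> carrier_mat m c" "stack_components M = E"
proof
  let ?M = "mat m c (\<lambda>(i, j). RBQ (E $$ (i, j)) (E $$ (m + i, j)) (E $$ (m + (m + i), j))
    (E $$ (m + (m + (m + i)), j)))"
  show "?M \<in> carrier_mat m c"
    by simp
  show "stack_components ?M = E"
    using E by (intro eq_matI) (auto simp: stack_components_def index_append_rows)
qed

text \<open>The norm of an entry is the Euclidean norm of its four components, so stacking is an
  isometry.\<close>

lemma frobenius_norm_eq_stack: "frobenius_norm M = sqrt (frob2 (stack_components M))"
proof -
  have "frob2 (stack_components M) = frob2 (map_mat rb0 M) + (frob2 (map_mat rb1 M)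
      + (frob2 (map_mat rb2 M) + frob2 (map_mat rb3 M)))"
    by (simp add: stack_components_def frob2_append_rows)
  also have "\<dots> = (\<Sum>i<dim_row M. \<Sum>j<dim_col M. (norm (M $$ (i, j)))\<^sup>2)"
    by (simp add: frob2_def norm_rbq_def add.assoc flip: sum.distrib)
  finally show ?thesis
    by (simp add: frobenius_norm_def)
qed

lemma frobenius_norm_append_cols:
  assumes "E \<in> carrier_mat m a" "G \<in> carrier_mat m b"
  shows "frobenius_norm (E @\<^sub>c G) = sqrt (frob2 (stack_components E) + frob2 (stack_components G))"
proof -
  have "stack_components (E @\<^sub>c G) = stack_components E @\<^sub>c stack_components G"
    using assms by (intro eq_matI) (auto simp: stack_components_def index_append_rows index_append_cols)
  then show ?thesis
    using frob2_append_cols[OF stack_components_carrier stack_components_carrier, OF assms]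
    by (simp add: frobenius_norm_eq_stack)
qed

text \<open>Independence over the reals is exactly injectivity of the stacked matrix. The vector is
  treated as a one-column matrix so that the product rule for stacking applies.\<close>

lemma full_column_rank_stackD:
  assumes rank: "full_column_rank M" and M: "M \<in> carrier_mat m c"
    and v: "v \<in> carrier_vec c" and 0: "stack_components M *\<^sub>v v = 0\<^sub>v (4 * m)"
  shows "v = 0\<^sub>v c"
proof -
  define X where "X = mat_of_cols c [v]"
  have X: "X \<in> carrier_mat c 1"
    using mat_of_cols_carrier(1)[of c "[v]"] by (simp add: X_def)
  have X_eq: "X $$ (i, 0) = v $ i" if "i < c" for i
    using that by (simp add: X_def mat_of_cols_index)
  have "stack_components M * X = 0\<^sub>m (4 * m) 1"
  proof (rule eq_matI)
    fix i j assume ij: "i < dim_row (0\<^sub>m (4 * m) 1 :: real mat)" "j < dim_col (0\<^sub>m (4 * m) 1 :: real mat)"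
    have "(stack_components M * X) $$ (i, j) = (stack_components M *\<^sub>v v) $ i"
      using ij stack_components_carrier[OF M] X X_eq v by (simp add: scalar_prod_def)
    then show "(stack_components M * X) $$ (i, j) = 0\<^sub>m (4 * m) 1 $$ (i, j)"
      using ij 0 by simp
  qed (use stack_components_carrier[OF M] X in auto)
  also have "\<dots> = stack_components (0\<^sub>m m 1)"
    by (intro eq_matI) (auto simp: stack_components_def index_append_rows rb_zero)
  finally have "M * rbq_mat_of_real X = 0\<^sub>m m 1"
    using stack_components_mult_real[OF M X] M X
      stack_components_eq_iff[of "M * rbq_mat_of_real X" m 1 "0\<^sub>m m 1"] by simp
  have "M *\<^sub>v map_vec of_real v = 0\<^sub>v m"
  proof (rule eq_vecI)
    fix i assume i: "i < dim_vec (0\<^sub>v m :: rbq vec)"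
    have "(M *\<^sub>v map_vec of_real v) $ i = (M * rbq_mat_of_real X) $$ (i, 0)"
      using i M X X_eq v by (simp add: scalar_prod_def)
    then show "(M *\<^sub>v map_vec of_real v) $ i = 0\<^sub>v m $ i"
      using i \<open>M * rbq_mat_of_real X = 0\<^sub>m m 1\<close> by simp
  qed (use M in auto)
  then show ?thesis
    using rank M v unfolding full_column_rank_def by auto
qed

text \<open>Links the predicate \<open>invertible_mat\<close> to the computed inverse. The predicate
  does not fix the shape of the inverse, so its dimensions are first read off from the two product
  equations.\<close>

lemma mat_inv_invertible:
  assumes A: "A \<in> carrier_mat n n" and inv: "invertible_mat A"
  shows "mat_inv A \<in> carrier_mat n n" "A * mat_inv A = 1\<^sub>m n" "mat_inv A * A = 1\<^sub>m n"
proof -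
  obtain B where AB: "A * B = 1\<^sub>m n" and BA: "B * A = 1\<^sub>m (dim_row B)"
    using inv A by (auto simp: invertible_mat_def inverts_mat_def)
  have "dim_row B = n" "dim_col B = n"
    using arg_cong[OF AB, of dim_col] arg_cong[OF BA, of dim_col] A by auto
  then have "B \<in> carrier_mat n n" "B * A = 1\<^sub>m n"
    using BA by auto
  then have "A \<in> Units (ring_mat TYPE(real) n ())"
    using A AB by (auto simp: Units_def ring_mat_def)
  then obtain C where "mat_inverse A = Some C"
    using mat_inverse(1)[OF A, of "()"] by (cases "mat_inverse A") auto
  then show "mat_inv A \<in> carrier_mat n n" "A * mat_inv A = 1\<^sub>m n" "mat_inv A * A = 1\<^sub>m n"
    using mat_inverse(2)[OF A] by auto
qed

text \<open>\<open>Q\<close> is injective and can be cancelled, after which the upper and lower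
  block rows separate. \<open>Xa\<close> occurs only in the upper one.\<close>

lemma orthogonal_reduction_iff:
  fixes Q :: "real mat"
  assumes Q: "real_orthogonal (a + p) Q"
    and R: "R11 \<in> carrier_mat a n1" "R12 \<in> carrier_mat a n2" "R1d \<in> carrier_mat a d"
      "R22 \<in> carrier_mat p n2" "R2d \<in> carrier_mat p d"
    and E: "E1 \<in> carrier_mat a n2" "E2 \<in> carrier_mat p n2"
    and G: "G1 \<in> carrier_mat a d" "G2 \<in> carrier_mat p d"
    and X: "Xa \<in> carrier_mat n1 d" "Xb \<in> carrier_mat n2 d"
  shows "Q * (R11 @\<^sub>r 0\<^sub>m p n1) * Xa + (Q * (R12 @\<^sub>r R22) + Q * (E1 @\<^sub>r E2)) * Xb
      = Q * (R1d @\<^sub>r R2d) + Q * (G1 @\<^sub>r G2)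
    \<longleftrightarrow> R11 * Xa + (R12 + E1) * Xb = R1d + G1 \<and> (R22 + E2) * Xb = R2d + G2"
    (is "?l = ?r \<longleftrightarrow> _")
proof -
  note Q' = real_orthogonalD[OF Q]
  define L1 where "L1 = R11 * Xa + (R12 + E1) * Xb"
  define L2 where "L2 = (R22 + E2) * Xb"
  have L: "L1 \<in> carrier_mat a d" "L2 \<in> carrier_mat p d"
    unfolding L1_def L2_def using R E X
    by (auto intro!: add_carrier_mat mult_carrier_mat[of _ p n2] mult_carrier_mat[of _ a n1] mult_carrier_mat[of _ a n2])
  have A: "R11 @\<^sub>r 0\<^sub>m p n1 \<in> carrier_mat (a + p) n1" "R12 @\<^sub>r R22 \<in> carrier_mat (a + p) n2"
    "E1 @\<^sub>r E2 \<in> carrier_mat (a + p) n2" "R1d @\<^sub>r R2d \<in> carrier_mat (a + p) d"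
    "G1 @\<^sub>r G2 \<in> carrier_mat (a + p) d"
    using R E G by auto
  have LL: "L1 @\<^sub>r L2 \<in> carrier_mat (a + p) d" and GG: "(R1d + G1) @\<^sub>r (R2d + G2) \<in> carrier_mat (a + p) d"
    using L R G by auto
  have AX: "(R11 @\<^sub>r 0\<^sub>m p n1) * Xa = R11 * Xa @\<^sub>r 0\<^sub>m p d"
    using R X by (subst append_rows_mult) auto
  have BX: "((R12 @\<^sub>r R22) + (E1 @\<^sub>r E2)) * Xb = (R12 + E1) * Xb @\<^sub>r L2"
    using R E X by (simp add: add_append_rows append_rows_mult L2_def)
  have "?l = Q * ((R11 @\<^sub>r 0\<^sub>m p n1) * Xa) + Q * ((R12 @\<^sub>r R22) + (E1 @\<^sub>r E2)) * Xb"
    using assoc_mult_mat[OF Q'(1) A(1) X(1)] mult_add_distrib_mat[OF Q'(1) A(2,3)] by simp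
  also have "\<dots> = Q * (R11 * Xa @\<^sub>r 0\<^sub>m p d) + Q * ((R12 + E1) * Xb @\<^sub>r L2)"
    using assoc_mult_mat[OF Q'(1) add_carrier_mat[OF A(3)] X(2)] AX BX by simp
  also have "\<dots> = Q * ((R11 * Xa @\<^sub>r 0\<^sub>m p d) + ((R12 + E1) * Xb @\<^sub>r L2))"
    by (rule mult_add_distrib_mat[symmetric, OF Q'(1)]) (use R E X L in auto)
  also have "(R11 * Xa @\<^sub>r 0\<^sub>m p d) + ((R12 + E1) * Xb @\<^sub>r L2) = L1 @\<^sub>r L2"
    using R E X L by (simp add: add_append_rows L1_def)
  finally have l: "?l = Q * (L1 @\<^sub>r L2)" .
  have r: "?r = Q * ((R1d + G1) @\<^sub>r (R2d + G2))"
    using mult_add_distrib_mat[OF Q'(1) A(4,5)] R G by (simp add: add_append_rows)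
  have "?l = ?r \<longleftrightarrow> L1 @\<^sub>r L2 = (R1d + G1) @\<^sub>r (R2d + G2)"
    unfolding l r using real_orthogonal_cancel(1)[OF Q LL] real_orthogonal_cancel(1)[OF Q GG] by metis
  also have "\<dots> \<longleftrightarrow> L1 = R1d + G1 \<and> L2 = R2d + G2"
    using L R G by (intro append_rows_eq_iff) auto
  finally show ?thesis
    by (simp add: L1_def L2_def)
qed

theorem theorem3p3:
  fixes m n n1 n2 d :: nat
    and A Aa Ab B :: "rbq mat"
    and Ca Cb D Q R11 R12 R1d R22 R2d U V V11 V12 V21 V22 :: "real mat"
    and \<sigma> :: "nat \<Rightarrow> real"
  assumes dims: "m \<ge> 1" "n \<ge> 1" "d \<ge> 1" "n2 \<ge> 1" "n1 + n2 = n" "m > n" "m \<ge> n + d"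
    and Aa: "Aa \<in> carrier_mat m n1" "full_column_rank Aa"
    and Ab: "Ab \<in> carrier_mat m n2"
    and A: "A = Aa @\<^sub>c Ab"
    and B: "B \<in> carrier_mat m d"
    and Ca: "Ca = stack_components Aa"
    and Cb: "Cb = stack_components Ab"
    and D: "D = stack_components B"
    and Q: "real_orthogonal (4 * m) Q"
      "\<exists>Hs. length Hs = n1 \<and> (\<forall>H \<in> set Hs. householder (4 * m) H) \<and>
            Q = foldr (*) Hs (1\<^sub>m (4 * m))"
    and R: "R11 \<in> carrier_mat n1 n1" "upper_triangular R11"
      "R12 \<in> carrier_mat n1 n2" "R1d \<in> carrier_mat n1 d"
      "R22 \<in> carrier_mat (4 * m - n1) n2" "R2d \<in> carrier_mat (4 * m - n1) d"
    and QR: "transpose_mat Q * (Ca @\<^sub>c Cb @\<^sub>c D) =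
      (R11 @\<^sub>c R12 @\<^sub>c R1d) @\<^sub>r (0\<^sub>m (4 * m - n1) n1 @\<^sub>c R22 @\<^sub>c R2d)"
    and UV: "real_orthogonal (4 * m - n1) U" "real_orthogonal (n2 + d) V"
    and SVD: "R22 @\<^sub>c R2d = U * rect_diag (4 * m - n1) (n2 + d) \<sigma> * transpose_mat V"
    and sigma: "\<forall>i. 1 \<le> i \<and> i < n2 + d \<longrightarrow> \<sigma> i \<ge> \<sigma> (i + 1)" "\<sigma> (n2 + d) > 0"
    and V: "V11 \<in> carrier_mat n2 n2" "V12 \<in> carrier_mat n2 d"
      "V21 \<in> carrier_mat d n2" "V22 \<in> carrier_mat d d"
      "V = four_block_mat V11 V12 V21 V22"
    and gap: "\<sigma> n2 > \<sigma> (n2 + 1)"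
    and V22: "invertible_mat V22"
  shows "invertible_mat R11 \<and>
    (\<exists>!X. real_RBMTLS_solution Aa Ab B X) \<and>
    real_RBMTLS_solution Aa Ab B
      (((mat_inv R11 * R1d) @\<^sub>r 0\<^sub>m n2 d) +
       ((mat_inv R11 * R12) @\<^sub>r (- 1\<^sub>m n2)) * V12 * mat_inv V22)"
proof -
  \<comment> \<open>The row count of \<open>R22\<close>. Since \<open>n1 < m\<close>, the truncated
    subtraction is exact.\<close>
  define p where "p = 4 * m - n1"
  have N: "4 * m = n1 + p"
    using dims by (simp add: p_def)
  note R = R[folded p_def]
  have U: "real_orthogonal p U"
    using UV(1) by (simp add: p_def)
  have QN: "real_orthogonal (n1 + p) Q"
    using Q(1) by (simp only: N)
  note Q' = real_orthogonalD[OF QN]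
  have stack: "stack_components M \<in> carrier_mat (n1 + p) c" if "M \<in> carrier_mat m c" for M c
    using stack_components_carrier[OF that] by (simp add: N)
  have C_carrier: "Ca \<in> carrier_mat (n1 + p) n1" "Cb \<in> carrier_mat (n1 + p) n2" "D \<in> carrier_mat (n1 + p) d"
    using stack Aa(1) Ab B by (simp_all add: Ca Cb D)
  have T: "R11 @\<^sub>r 0\<^sub>m p n1 \<in> carrier_mat (n1 + p) n1" "R12 @\<^sub>r R22 \<in> carrier_mat (n1 + p) n2"
    "R1d @\<^sub>r R2d \<in> carrier_mat (n1 + p) d"
    using R by auto
  have "transpose_mat Q * Ca @\<^sub>c transpose_mat Q * Cb @\<^sub>c transpose_mat Q * D
      = (R11 @\<^sub>r 0\<^sub>m p n1) @\<^sub>c (R12 @\<^sub>r R22) @\<^sub>c (R1d @\<^sub>r R2d)"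
  proof -
    have "transpose_mat Q * (Ca @\<^sub>c Cb @\<^sub>c D)
        = transpose_mat Q * Ca @\<^sub>c transpose_mat Q * Cb @\<^sub>c transpose_mat Q * D"
      using mult_append_cols[OF C_carrier(1) append_cols_carrier[OF C_carrier(2,3)] Q'(2)]
        mult_append_cols[OF C_carrier(2,3) Q'(2)] by simp
    moreover have "(R11 @\<^sub>c R12 @\<^sub>c R1d) @\<^sub>r (0\<^sub>m p n1 @\<^sub>c R22 @\<^sub>c R2d)
        = (R11 @\<^sub>r 0\<^sub>m p n1) @\<^sub>c (R12 @\<^sub>r R22) @\<^sub>c (R1d @\<^sub>r R2d)"
      using append_append_cols_append_rows[OF R(3,4) R(5,6)]
        append_append_cols_append_rows[OF R(1) append_cols_carrier[OF R(3,4)] zero_carrier_mat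
          append_cols_carrier[OF R(5,6)]] by simp
    ultimately show ?thesis
      using QR by (simp add: p_def)
  qed
  moreover have QC: "transpose_mat Q * Ca \<in> carrier_mat (n1 + p) n1"
    "transpose_mat Q * Cb \<in> carrier_mat (n1 + p) n2" "transpose_mat Q * D \<in> carrier_mat (n1 + p) d"
    using Q' C_carrier by simp_all
  ultimately have "transpose_mat Q * Ca = R11 @\<^sub>r 0\<^sub>m p n1 \<and> transpose_mat Q * Cb = R12 @\<^sub>r R22
      \<and> transpose_mat Q * D = R1d @\<^sub>r R2d"
    by (simp only: append_cols_eq_iff[OF QC(1) T(1) append_cols_carrier[OF QC(2,3)] append_cols_carrier[OF T(2,3)]]
        append_cols_eq_iff[OF QC(2) T(2) QC(3) T(3)])
  then have C_eq: "Ca = Q * (R11 @\<^sub>r 0\<^sub>m p n1)" "Cb = Q * (R12 @\<^sub>r R22)" "D = Q * (R1d @\<^sub>r R2d)"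
    using real_orthogonal_cancel(2)[OF QN] C_carrier by metis+

  \<comment> \<open>A kernel vector of \<open>R11\<close> is also killed by
    \<open>Ca = Q [R11; 0]\<close>, against the full column rank of \<open>Aa\<close>.\<close>
  have R11_inj: "v = 0\<^sub>v n1" if v: "v \<in> carrier_vec n1" and 0: "R11 *\<^sub>v v = 0\<^sub>v n1" for v
  proof -
    have "Ca *\<^sub>v v = Q *\<^sub>v ((R11 @\<^sub>r 0\<^sub>m p n1) *\<^sub>v v)"
      unfolding C_eq(1) by (rule assoc_mult_mat_vec[OF Q'(1) T(1) v])
    also have "(R11 @\<^sub>r 0\<^sub>m p n1) *\<^sub>v v = 0\<^sub>v (n1 + p)"
      using mat_mult_append[OF R(1) zero_carrier_mat v, of p] 0 v by auto
    finally have "Ca *\<^sub>v v = 0\<^sub>v (4 * m)"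
      using Q' by (auto simp: N)
    then show ?thesis
      using full_column_rank_stackD[OF Aa(2,1) v] by (simp add: Ca)
  qed
  obtain J0 where "J0 \<in> carrier_mat n1 n1" "R11 * J0 = 1\<^sub>m n1" "J0 * R11 = 1\<^sub>m n1"
    using obtain_mat_inverse[OF R(1) R11_inj] .
  then have R11_inv: "invertible_mat R11"
    using R(1) by (auto simp: invertible_mat_def inverts_mat_def intro!: exI[of _ J0])
  define J where "J = mat_inv R11"
  note J = mat_inv_invertible[OF R(1) R11_inv, folded J_def]
  define K where "K = mat_inv V22"
  note K = mat_inv_invertible[OF V(4) V22, folded K_def]
  interpret tls: tls_svd p n2 d R22 R2d U V V11 V12 V21 V22 K \<sigma>
    using dims R UV(2) U SVD V K sigma gap by unfold_locales (auto simp: p_def)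

  \<comment> \<open>The closed form of the solution\<close>
  define P where "P = V12 * K"
  have P: "P \<in> carrier_mat n2 d"
    using V K by (simp add: P_def)
  define Xa\<^sub>0 where "Xa\<^sub>0 = J * (R1d + R12 * P)"
  have RP: "R12 * P \<in> carrier_mat n1 d" "R1d + R12 * P \<in> carrier_mat n1 d"
    using R P by auto
  have Xa\<^sub>0: "Xa\<^sub>0 \<in> carrier_mat n1 d"
    using J RP by (simp add: Xa\<^sub>0_def)
  \<comment> \<open>With zero error in the upper block rows and \<open>Xb = - P\<close>, a square
    invertible system remains, and it determines \<open>Xa\<close>.\<close>
  have exact_iff: "R11 * Xa + R12 * (- P) = R1d \<longleftrightarrow> Xa = Xa\<^sub>0" if Xa: "Xa \<in> carrier_mat n1 d" for Xa
  proof -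
    have "R12 * (- P) = - (R12 * P)"
      using R P by (intro uminus_mult_right_mat) simp
    then have "R11 * Xa + R12 * (- P) = R1d \<longleftrightarrow> R11 * Xa = R1d + R12 * P"
      using add_uminus_eq_mat_iff[OF mult_carrier_mat[OF R(1) Xa] RP(1) R(4)] by (simp only:)
    also have "\<dots> \<longleftrightarrow> Xa = Xa\<^sub>0"
    proof
      assume "R11 * Xa = R1d + R12 * P"
      then have "Xa\<^sub>0 = J * R11 * Xa"
        unfolding Xa\<^sub>0_def using assoc_mult_mat[OF J(1) R(1) Xa] by (simp only:)
      then show "Xa = Xa\<^sub>0"
        using J(3) Xa by simp
    next
      assume "Xa = Xa\<^sub>0"
      then have "R11 * Xa = R11 * J * (R1d + R12 * P)"
        unfolding Xa\<^sub>0_def using assoc_mult_mat[OF R(1) J(1) RP(2)] by (simp only:)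
      then show "R11 * Xa = R1d + R12 * P"
        using J(2) left_mult_one_mat[OF RP(2)] by (simp only:)
    qed
    finally show ?thesis .
  qed
  define X where "X = ((J * R1d) @\<^sub>r 0\<^sub>m n2 d) + ((J * R12) @\<^sub>r (- 1\<^sub>m n2)) * V12 * K"
  have X_eq: "X = Xa\<^sub>0 @\<^sub>r (- P)"
  proof -
    have JR: "(J * R12) @\<^sub>r (- 1\<^sub>m n2) \<in> carrier_mat (n1 + n2) n2"
      using J R by (intro carrier_append_rows) auto
    have "((J * R12) @\<^sub>r (- 1\<^sub>m n2)) * V12 * K = ((J * R12) @\<^sub>r (- 1\<^sub>m n2)) * P"
      using assoc_mult_mat[OF JR V(2) K(1)] by (simp add: P_def)
    also have "\<dots> = J * (R12 * P) @\<^sub>r (- P)"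
      using J R P assoc_mult_mat[OF J(1) R(3) P] uminus_mult_left_mat[of "1\<^sub>m n2" P]
      by (simp add: append_rows_mult)
    finally show ?thesis
      using J R P RP mult_add_distrib_mat[OF J(1) R(4) RP(1)]
      by (simp add: X_def add_append_rows Xa\<^sub>0_def)
  qed

  \<comment> \<open>\<open>E1\<close>, \<open>E2\<close>, \<open>G1\<close>, \<open>G2\<close> are
    the upper and lower blocks of the stacked errors after rotation by
    \<open>transpose_mat Q\<close>.\<close>
  have feasible_iff: "RBMTLS_feasible Aa Ab B Xa Xb Eb G \<longleftrightarrow>
      R11 * Xa + (R12 + E1) * Xb = R1d + G1 \<and> (R22 + E2) * Xb = R2d + G2"
    and norm_eq: "frobenius_norm (Eb @\<^sub>c G) = sqrt ((frob2 E1 + frob2 G1) + (frob2 E2 + frob2 G2))"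
    if E: "E1 \<in> carrier_mat n1 n2" "E2 \<in> carrier_mat p n2" "G1 \<in> carrier_mat n1 d" "G2 \<in> carrier_mat p d"
      and X: "Xa \<in> carrier_mat n1 d" "Xb \<in> carrier_mat n2 d"
      and Eb: "Eb \<in> carrier_mat m n2" "stack_components Eb = Q * (E1 @\<^sub>r E2)"
      and G: "G \<in> carrier_mat m d" "stack_components G = Q * (G1 @\<^sub>r G2)"
    for Xa Xb Eb G E1 E2 G1 G2
  proof -
    have AX: "Aa * rbq_mat_of_real Xa \<in> carrier_mat m d" "Ab + Eb \<in> carrier_mat m n2"
      "(Ab + Eb) * rbq_mat_of_real Xb \<in> carrier_mat m d"
      using Aa Ab Eb X by auto
    have "RBMTLS_feasible Aa Ab B Xa Xb Eb G \<longleftrightarrow>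
        stack_components (Aa * rbq_mat_of_real Xa + (Ab + Eb) * rbq_mat_of_real Xb) = stack_components (B + G)"
      using AX Aa Ab B Eb G X
      by (subst stack_components_eq_iff[of _ m d]) (auto simp: RBMTLS_feasible_def)
    also have "\<dots> \<longleftrightarrow> Ca * Xa + (Cb + stack_components Eb) * Xb = D + stack_components G"
      by (simp only: stack_components_add[OF AX(1,3)] stack_components_mult_real[OF Aa(1) X(1)]
          stack_components_mult_real[OF AX(2) X(2)] stack_components_add[OF Ab Eb(1)]
          stack_components_add[OF B G(1)] Ca Cb D)
    also have "\<dots> \<longleftrightarrow> R11 * Xa + (R12 + E1) * Xb = R1d + G1 \<and> (R22 + E2) * Xb = R2d + G2"
      unfolding Eb(2) G(2) C_eq using orthogonal_reduction_iff[OF QN R(1,3,4,5,6) E X] .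
    finally show "RBMTLS_feasible Aa Ab B Xa Xb Eb G \<longleftrightarrow>
      R11 * Xa + (R12 + E1) * Xb = R1d + G1 \<and> (R22 + E2) * Xb = R2d + G2" .
    have "frob2 (Q * (E1 @\<^sub>r E2)) = frob2 E1 + frob2 E2" "frob2 (Q * (G1 @\<^sub>r G2)) = frob2 G1 + frob2 G2"
      using E frob2_orthogonal_left[OF QN carrier_append_rows] by (simp_all add: frob2_append_rows)
    then show "frobenius_norm (Eb @\<^sub>c G) = sqrt ((frob2 E1 + frob2 G1) + (frob2 E2 + frob2 G2))"
      using frobenius_norm_append_cols[OF Eb(1) G(1)] by (simp add: Eb(2) G(2))
  qed

  have lower: "sqrt tls.tail \<le> frobenius_norm (Eb @\<^sub>c G)"
    and unique: "frobenius_norm (Eb @\<^sub>c G) \<le> sqrt tls.tail \<Longrightarrow> Xa @\<^sub>r Xb = X"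
    if feas: "RBMTLS_feasible Aa Ab B Xa Xb Eb G" for Xa Xb Eb G
  proof -
    have Xc: "Xa \<in> carrier_mat n1 d" "Xb \<in> carrier_mat n2 d"
      and Eb: "Eb \<in> carrier_mat m n2" and G: "G \<in> carrier_mat m d"
      using feas Aa Ab B by (auto simp: RBMTLS_feasible_def)
    have "transpose_mat Q * stack_components Eb \<in> carrier_mat (n1 + p) n2"
      "transpose_mat Q * stack_components G \<in> carrier_mat (n1 + p) d"
      using Q' stack[OF Eb] stack[OF G] by simp_all
    then obtain E1 E2 G1 G2 where E: "E1 \<in> carrier_mat n1 n2" "E2 \<in> carrier_mat p n2"
        "G1 \<in> carrier_mat n1 d" "G2 \<in> carrier_mat p d"
      and "transpose_mat Q * stack_components Eb = E1 @\<^sub>r E2" "transpose_mat Q * stack_components G = G1 @\<^sub>r G2"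
      by (metis obtain_append_rows)
    then have EG: "stack_components Eb = Q * (E1 @\<^sub>r E2)" "stack_components G = Q * (G1 @\<^sub>r G2)"
      using real_orthogonal_cancel(2)[OF QN] stack[OF Eb] stack[OF G] by metis+
    note iff = feasible_iff[OF E Xc Eb EG(1) G EG(2)] and norm = norm_eq[OF E Xc Eb EG(1) G EG(2)]
    have eqs: "R11 * Xa + (R12 + E1) * Xb = R1d + G1" "(R22 + E2) * Xb = R2d + G2"
      using iff feas by simp_all
    note bound = tls.bound[OF E(2,4) Xc(2) eqs(2)]
    note nn = frob2_nonneg[of E1] frob2_nonneg[of G1]
    show "sqrt tls.tail \<le> frobenius_norm (Eb @\<^sub>c G)"
      unfolding norm using bound(1) nn by simp
    assume "frobenius_norm (Eb @\<^sub>c G) \<le> sqrt tls.tail"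
    then have le: "(frob2 E1 + frob2 G1) + (frob2 E2 + frob2 G2) \<le> tls.tail"
      by (simp add: norm)
    \<comment> \<open>The lower blocks alone already cost at least \<open>tls.tail\<close>, so at
      optimal cost nothing is left for the upper blocks.\<close>
    then have "frob2 E1 = 0" "frob2 G1 = 0" and "frob2 E2 + frob2 G2 \<le> tls.tail"
      using bound(1) nn by linarith+
    then have "E1 = 0\<^sub>m n1 n2" "G1 = 0\<^sub>m n1 d" and Xb: "Xb = - P"
      using frob2_eq_0D E bound(2) by (auto simp: P_def)
    then have "R11 * Xa + R12 * (- P) = R1d"
      using eqs(1) R by simp
    then show "Xa @\<^sub>r Xb = X"
      using exact_iff[OF Xc(1)] by (simp add: X_eq Xb)
  qed

  \<comment> \<open>A feasible point of minimal cost\<close>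
  obtain E2 G2 where E2: "E2 \<in> carrier_mat p n2" and G2: "G2 \<in> carrier_mat p d"
    and constr: "(R22 + E2) * (- P) = R2d + G2" and tail: "frob2 E2 + frob2 G2 = tls.tail"
    using tls.attained unfolding P_def by blast
  \<comment> \<open>The optimal reduced errors are padded with zero upper blocks, rotated back by
    \<open>Q\<close> and then unstacked.\<close>
  have "Q * (0\<^sub>m n1 n2 @\<^sub>r E2) \<in> carrier_mat (4 * m) n2" "Q * (0\<^sub>m n1 d @\<^sub>r G2) \<in> carrier_mat (4 * m) d"
    using Q'(1) E2 G2 by (auto simp: N intro!: mult_carrier_mat carrier_append_rows)
  then obtain Eb G where Eb: "Eb \<in> carrier_mat m n2" "stack_components Eb = Q * (0\<^sub>m n1 n2 @\<^sub>r E2)"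
    and G: "G \<in> carrier_mat m d" "stack_components G = Q * (0\<^sub>m n1 d @\<^sub>r G2)"
    by (metis obtain_stack_components)
  have nP: "- P \<in> carrier_mat n2 d"
    using P by simp
  have "R11 * Xa\<^sub>0 + (R12 + 0\<^sub>m n1 n2) * (- P) = R1d + 0\<^sub>m n1 d"
    using exact_iff[OF Xa\<^sub>0] R by simp
  then have feas: "RBMTLS_feasible Aa Ab B Xa\<^sub>0 (- P) Eb G"
    using feasible_iff[OF zero_carrier_mat E2 zero_carrier_mat G2 Xa\<^sub>0 nP Eb G] constr by simp
  have norm: "frobenius_norm (Eb @\<^sub>c G) = sqrt tls.tail"
    using norm_eq[OF zero_carrier_mat E2 zero_carrier_mat G2 Xa\<^sub>0 nP Eb G] tail by (simp add: frob2_def)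
  have sol: "real_RBMTLS_solution Aa Ab B X"
    unfolding real_RBMTLS_solution_def RBMTLS_minimizer_def
    using X_eq feas norm lower by metis
  \<comment> \<open>A minimizer costs at most as much as the feasible point just built, that is
    \<open>sqrt tls.tail\<close>, so \<open>unique\<close> applies.\<close>
  moreover have "X' = X" if "real_RBMTLS_solution Aa Ab B X'" for X'
    using that feas norm unique unfolding real_RBMTLS_solution_def RBMTLS_minimizer_def by metis
  ultimately have "\<exists>!X. real_RBMTLS_solution Aa Ab B X"
    by blast
  then show ?thesis
    using R11_inv sol by (simp add: X_def J_def K_def)
qed

end
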